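(* Let $4\le i<n$, and take $\alpha=\frac14$, $c=\frac12$ in a field $\mathbb F$ of characteristic $0$. Put $\eta(j)=\eta_{1/4}(j)$ and $\hat\eta(j)=\hat\eta_{1/4}(j)$, where $$\eta_\alpha(j)=\frac{\alpha(j+1)}{2+2\alpha(j-1)},\qquad \hat\eta_\alpha(j)=\frac{\alpha j}{1+\alpha(j-1)}.$$ Then in $M^{1/2}_{1/4}(\mathcal A_n^\pm)$ the idempotents $e_i=\mathrm{id}_i-\mathrm{id}_{i-1}$ and $\hat e_i=\hat{\mathrm{id}}_i-\mathrm{id}_i$ have central charges $$\mathrm{cc}(e_i)=1-\frac{6}{(i+2)(i+3)}=c_i,\qquad \mathrm{cc}(\hat e_i)=\frac{2i}{i+3},$$ and the elements of $\mathrm{Spec}(e_i)$ other than $1$, namely $0,\ \eta(i),\ 1-\eta(i-1),\ \eta(i)-\eta(i-1),\ \hat\eta(i)-\eta(i-1),\ \hat\eta(i)-\hat\eta(i-1)$, are given by $$0=h^i_{1,1},\qquad \eta(i)=\frac12\frac{i+1}{i+3}=\frac12h^i_{1,3},\qquad 1-\eta(i-1)=\frac12\frac{i+4}{i+2}=\frac12h^i_{3,1},$$ $$\eta(i)-\eta(i-1)=\frac1{(i+2)(i+3)}=\frac12h^i_{3,3},\qquad \hat\eta(i)-\eta(i-1)=\frac12\frac{i(i+1)}{(i+2)(i+3)}=\frac12h^i_{3,5},$$ $$\hat\eta(i)-\hat\eta(i-1)=\frac3{(i+2)(i+3)}=\frac12h^i_{5,5}.$$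
   Context: **Virasoro weights.** $c_i=1-\frac{6}{(i+2)(i+3)}$, and $h^i_{r,s}=\frac{(r(i+3)-s(i+2))^2-1}{4(i+2)(i+3)}$ are the highest weights of the Virasoro algebra at central charge $c_i$. **Fischer spaces.** $\mathcal A_j$ is the Fischer space of $\mathrm{Sym}(j+1)$: points are the transpositions, lines are the sets $\{(a,b),(b,d),(a,d)\}$ for distinct letters $a,b,d$. For distinct points $x,y$, $x\sim y$ means they lie on a common line, whose third point is $x\wedge y$. The double graph $\mathcal G^\pm$ of a Fischer space $\mathcal G$ has points $x^+,x^-$ for $x\in\mathcal G$ and lines $\{x^\varepsilon,y^\eta,(x\wedge y)^{\varepsilon\eta}\}$ for $x\sim y$ and $\varepsilon,\eta\in\{+,-\}$; $\mathcal G\subseteq\mathcal G^\pm$ via $x\mapsto x^+$. **Matsuo algebra.** $M_\alpha^c(\mathcal G)$ is the $\mathbb F$-algebra with basis the points of $\mathcal G$ and product $xx=x$; $xy=0$ if $x\ne y$, $x\not\sim y$; $xy=\frac\alpha2(x+y-x\wedge y)$ if $x\sim y$; equipped with the bilinear form $(x,x)=2c$, $(x,y)=0$ if $x\neq y$, $x\not\sim y$, $(x,y)=c\alpha$ if $x\sim y$. The central charge of an idempotent $e$ is $\mathrm{cc}(e)=\frac12(e,e)$, and $\mathrm{Spec}(e)$ is the set of eigenvalues of multiplication by $e$. **Idempotents.** Fix $\mathcal A_0\subseteq\dots\subseteq\mathcal A_n$ coming from $\mathrm{Sym}(1)\subseteq\dots\subseteq\mathrm{Sym}(n+1)$. In $M^c_\alpha(\mathcal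 A_n^\pm)$, $\mathrm{id}_j$ and $\hat{\mathrm{id}}_j$ are the identity elements of the subalgebras spanned by $\mathcal A_j\subseteq\mathcal A_n^\pm$ and $\mathcal A_j^\pm\subseteq\mathcal A_n^\pm$ respectively. *)

theory Defs
  imports "HOL-Library.Poly_Mapping" "HOL-Combinatorics.Transposition"
begin

section \<open>Fischer spaces\<close>

record 'p point_line_space =
  points :: "'p set"
  lines :: "'p set set"

definition collinear :: "'p point_line_space \<Rightarrow> 'p \<Rightarrow> 'p \<Rightarrow> bool" where
  "collinear G x y \<longleftrightarrow> x \<noteq> y \<and> (\<exists>l\<in>lines G. x \<in> l \<and> y \<in> l)"

text \<open>Only meaningful for collinear \<open>x\<close> and \<open>y\<close>, where it is the point written \<open>x \<and> y\<close>.\<close>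

definition third_point :: "'p point_line_space \<Rightarrow> 'p \<Rightarrow> 'p \<Rightarrow> 'p" where
  "third_point G x y = (THE z. z \<noteq> x \<and> z \<noteq> y \<and> {x, y, z} \<in> lines G)"

text \<open>
  The Fischer space of \<open>Sym(j+1)\<close>, acting on the letters \<open>1, \<dots>, j+1\<close>. A transposition is a
  permutation of all of \<open>nat\<close> fixing every other letter, so that the inclusions
  \<open>Sym(1) \<subseteq> Sym(2) \<subseteq> \<dots>\<close> are literal inclusions of point sets.
\<close>

definition sym_space :: "nat \<Rightarrow> (nat \<Rightarrow> nat) point_line_space" where
  "sym_space j =
    \<lparr> points = {transpose a b | a b. a \<in> {1..j+1} \<and> b \<in> {1..j+1} \<and> a \<noteq> b},
      lines = {{transpose a b, transpose b d, transpose a d} | a b d.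
                 a \<in> {1..j+1} \<and> b \<in> {1..j+1} \<and> d \<in> {1..j+1}
                 \<and> a \<noteq> b \<and> b \<noteq> d \<and> a \<noteq> d} \<rparr>"

text \<open>The point \<open>(x, \<epsilon>)\<close> with \<open>\<epsilon> = 1\<close> or \<open>\<epsilon> = -1\<close> stands for \<open>x\<^sup>+\<close> or \<open>x\<^sup>-\<close>.\<close>

definition double_space :: "'p point_line_space \<Rightarrow> ('p \<times> int) point_line_space" where
  "double_space G =
    \<lparr> points = points G \<times> {1, -1},
      lines = {{(x, \<epsilon>), (y, \<eta>), (third_point G x y, \<epsilon> * \<eta>)} | x y \<epsilon> \<eta>.
                 x \<in> points G \<and> y \<in> points G \<and> collinear G x y
                 \<and> \<epsilon> \<in> {1, -1} \<and> \<eta> \<in> {1, -1}} \<rparr>"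


section \<open>Matsuo algebras\<close>

text \<open>
  The vector space with basis \<open>S\<close> consists of the finitely supported functions
  whose support lies in \<open>S\<close>; the basis vector of the point \<open>x\<close> is \<open>Poly_Mapping.single x 1\<close>.
  For \<open>S \<subseteq> T\<close>, \<open>free_space S\<close> is the linear span of \<open>S\<close> inside \<open>free_space T\<close>.
  The convolution product that the library puts on \<open>\<Rightarrow>\<^sub>0\<close> plays no role here.
\<close>

definition free_space :: "'p set \<Rightarrow> ('p \<Rightarrow>\<^sub>0 'f::zero) set" where
  "free_space S = {u. Poly_Mapping.keys u \<subseteq> S}"

definition scale :: "'f::field \<Rightarrow> ('p \<Rightarrow>\<^sub>0 'f) \<Rightarrow> ('p \<Rightarrow>\<^sub>0 'f)" where
  "scale a u = Poly_Mapping.map ((*) a) u"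

definition matsuo_point_mult ::
    "'f::field \<Rightarrow> 'p point_line_space \<Rightarrow> 'p \<Rightarrow> 'p \<Rightarrow> ('p \<Rightarrow>\<^sub>0 'f)" where
  "matsuo_point_mult \<alpha> G x y =
    (if x = y then Poly_Mapping.single x 1
     else if collinear G x y then
       scale (\<alpha> / 2) (Poly_Mapping.single x 1 + Poly_Mapping.single y 1
                      - Poly_Mapping.single (third_point G x y) 1)
     else 0)"

definition matsuo_mult ::
    "'f::field \<Rightarrow> 'p point_line_space \<Rightarrow> ('p \<Rightarrow>\<^sub>0 'f) \<Rightarrow> ('p \<Rightarrow>\<^sub>0 'f) \<Rightarrow> ('p \<Rightarrow>\<^sub>0 'f)" where
  "matsuo_mult \<alpha> G u v =
    (\<Sum>x\<in>Poly_Mapping.keys u. \<Sum>y\<in>Poly_Mapping.keys v.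
       scale (Poly_Mapping.lookup u x * Poly_Mapping.lookup v y)
             (matsuo_point_mult \<alpha> G x y))"

definition matsuo_point_form ::
    "'f::field \<Rightarrow> 'f \<Rightarrow> 'p point_line_space \<Rightarrow> 'p \<Rightarrow> 'p \<Rightarrow> 'f" where
  "matsuo_point_form \<alpha> c G x y =
    (if x = y then 2 * c else if collinear G x y then c * \<alpha> else 0)"

definition matsuo_form ::
    "'f::field \<Rightarrow> 'f \<Rightarrow> 'p point_line_space \<Rightarrow> ('p \<Rightarrow>\<^sub>0 'f) \<Rightarrow> ('p \<Rightarrow>\<^sub>0 'f) \<Rightarrow> 'f" where
  "matsuo_form \<alpha> c G u v =
    (\<Sum>x\<in>Poly_Mapping.keys u. \<Sum>y\<in>Poly_Mapping.keys v.
       Poly_Mapping.lookup u x * Poly_Mapping.lookup v y * matsuo_point_form \<alpha> c G x y)"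

definition idempotent ::
    "'f::field \<Rightarrow> 'p point_line_space \<Rightarrow> ('p \<Rightarrow>\<^sub>0 'f) \<Rightarrow> bool" where
  "idempotent \<alpha> G e \<longleftrightarrow> e \<in> free_space (points G) \<and> matsuo_mult \<alpha> G e e = e"

definition central_charge ::
    "'f::field \<Rightarrow> 'f \<Rightarrow> 'p point_line_space \<Rightarrow> ('p \<Rightarrow>\<^sub>0 'f) \<Rightarrow> 'f" where
  "central_charge \<alpha> c G e = 1 / 2 * matsuo_form \<alpha> c G e e"

text \<open>Eigenvectors are sought in the whole algebra, i.e. in the span of all points of \<open>G\<close>.\<close>

definition Spec :: "'f::field \<Rightarrow> 'p point_line_space \<Rightarrow> ('p \<Rightarrow>\<^sub>0 'f) \<Rightarrow> 'f set" where
  "Spec \<alpha> G e =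
    {\<mu>. \<exists>v\<in>free_space (points G). v \<noteq> 0 \<and> matsuo_mult \<alpha> G e v = scale \<mu> v}"

definition is_identity_of ::
    "'f::field \<Rightarrow> 'p point_line_space \<Rightarrow> ('p \<Rightarrow>\<^sub>0 'f) set \<Rightarrow> ('p \<Rightarrow>\<^sub>0 'f) \<Rightarrow> bool" where
  "is_identity_of \<alpha> G B e \<longleftrightarrow>
    e \<in> B \<and> (\<forall>u\<in>B. matsuo_mult \<alpha> G e u = u \<and> matsuo_mult \<alpha> G u e = u)"

definition identity_of ::
    "'f::field \<Rightarrow> 'p point_line_space \<Rightarrow> ('p \<Rightarrow>\<^sub>0 'f) set \<Rightarrow> ('p \<Rightarrow>\<^sub>0 'f)" where
  "identity_of \<alpha> G B = (THE e. is_identity_of \<alpha> G B e)"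


section \<open>The double algebra of the symmetric group\<close>

abbreviation double_sym_space :: "nat \<Rightarrow> ((nat \<Rightarrow> nat) \<times> int) point_line_space" where
  "double_sym_space n \<equiv> double_space (sym_space n)"

definition id_sym :: "'f::field \<Rightarrow> nat \<Rightarrow> nat \<Rightarrow> ((nat \<Rightarrow> nat) \<times> int \<Rightarrow>\<^sub>0 'f)" where
  "id_sym \<alpha> n j =
    identity_of \<alpha> (double_sym_space n) (free_space ((\<lambda>x. (x, 1)) ` points (sym_space j)))"

definition id_hat :: "'f::field \<Rightarrow> nat \<Rightarrow> nat \<Rightarrow> ((nat \<Rightarrow> nat) \<times> int \<Rightarrow>\<^sub>0 'f)" where
  "id_hat \<alpha> n j =
    identity_of \<alpha> (double_sym_space n) (free_space (points (double_sym_space j)))"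

definition eta :: "'f::field \<Rightarrow> nat \<Rightarrow> 'f" where
  "eta \<alpha> j = \<alpha> * (of_nat j + 1) / (2 + 2 * \<alpha> * (of_nat j - 1))"

definition eta_hat :: "'f::field \<Rightarrow> nat \<Rightarrow> 'f" where
  "eta_hat \<alpha> j = \<alpha> * of_nat j / (1 + \<alpha> * (of_nat j - 1))"


section \<open>Virasoro central charges and highest weights\<close>

definition vir_c :: "nat \<Rightarrow> 'f::field" where
  "vir_c i = 1 - 6 / ((of_nat i + 2) * (of_nat i + 3))"

definition vir_h :: "nat \<Rightarrow> nat \<Rightarrow> nat \<Rightarrow> 'f::field" where
  "vir_h i r s =
    ((of_nat r * (of_nat i + 3) - of_nat s * (of_nat i + 2))^2 - 1)
      / (4 * (of_nat i + 2) * (of_nat i + 3))"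

end

theory Submission
  imports Defs
begin

text \<open>
  The identity elements can be written down. If \<open>B\<close> is a set of points closed under third points
  in which every point \<open>x\<close> has exactly \<open>D\<close> neighbours, then in the product of \<open>x\<close> with the sum of
  all points of \<open>B\<close> the terms \<open>y\<close> and \<open>- (x \<and> y)\<close> cancel, because \<open>y \<mapsto> x \<and> y\<close> permutes the
  neighbours of \<open>x\<close>; what remains is \<open>(1 + \<alpha> D / 2) x\<close>. So the identity of the span of \<open>B\<close> is the
  sum of its points divided by \<open>1 + \<alpha> D / 2\<close> (\<open>is_identity_scaled_sum\<close>). Differences of two such
  identities of nested subspaces are idempotents, and since \<open>(u, id) = 2c \<Sum> u\<^sub>x\<close> their
  central charges only need the number of points (\<open>central_charge_diff_scaled_sum\<close>).

  For the spectrum of \<open>e\<^sub>i\<close>, a vector is read as a pair \<open>(p, m)\<close> of functions on the edges of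
  the complete graph on the letters: \<open>p a b\<close> and \<open>m a b\<close> are its coefficients at \<open>(a,b)\<^sup>+\<close> and
  \<open>(a,b)\<^sup>-\<close>. Since \<open>e\<^sub>i\<close> only involves the points \<open>x\<^sup>+\<close>, multiplication by it is block
  triangular: it acts on \<open>m\<close> by \<open>\<alpha>/2\<close> times a weighted Laplacian, and on \<open>p\<close> by the same operator
  plus a coupling that lives on the edges inside \<open>{1..i+1}\<close> (\<open>lookup_mult_plus_supported\<close>).

  The weight only distinguishes the letters \<open>1..i\<close>, the letter \<open>i+1\<close> and the outer letters, so the
  Laplacian of a function is expressed by the function and its row sums. Summing the eigenvalue
  equation over both letters, then over one letter, then over none gives scalar equations
  \<open>(\<mu> - \<nu>) z = 0\<close>, in which \<open>\<nu>\<close> runs through the claimed eigenvalues. If \<open>\<mu>\<close> is none of them, all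
  coefficients vanish: first those of \<open>m\<close>, then those of \<open>p\<close> (\<open>layer_eigenpair_subset\<close>). In
  representation-theoretic terms, these stages separate the trivial constituents of the permutation
  modules of \<open>Sym(i)\<close> that occur, then the standard ones, and finally the Specht module of \<open>(i-2, 2)\<close>.

  Conversely every value has an explicit eigenvector. Two of them are supported on edges to one
  outer letter, two come from inner functions all of whose row sums vanish, one lies in the
  subalgebra of \<open>\<A>\<^sub>i\<close>, and \<open>0\<close> and \<open>1\<close> belong to a point of \<open>\<A>\<^bsub>i-1\<^esub>\<close> and to \<open>e\<^sub>i\<close> itself. This
  determines the spectrum for general \<open>\<alpha>\<close>, up to nondegeneracy conditions
  (\<open>spec_layer_idempotent\<close>); the value \<open>\<alpha> = 1/4\<close> only enters in the arithmetic that compares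
  with the Virasoro weights.
\<close>

section \<open>Matsuo algebras of partial triple systems\<close>

lemma lookup_scale [simp]: "Poly_Mapping.lookup (scale a u) x = a * Poly_Mapping.lookup u x"
  by (simp add: scale_def map.rep_eq when_def)

lemma free_space_lookup:
  "u \<in> free_space S \<longleftrightarrow> (\<forall>x. x \<notin> S \<longrightarrow> Poly_Mapping.lookup u x = 0)"
  by (auto simp: free_space_def in_keys_iff)

definition point_vector :: "'p set \<Rightarrow> ('p \<Rightarrow> 'f::comm_monoid_add) \<Rightarrow> ('p \<Rightarrow>\<^sub>0 'f)" where
  "point_vector S f = (\<Sum>x\<in>S. Poly_Mapping.single x (f x))"

lemma lookup_point_vector: "finite S \<Longrightarrow> Poly_Mapping.lookup (point_vector S f) x = (if x \<in> S then f x else 0)"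
  by (simp add: point_vector_def lookup_sum lookup_single when_def)

lemma point_vector_in_free_space: "finite S \<Longrightarrow> S \<subseteq> T \<Longrightarrow> point_vector S f \<in> free_space T"
  by (auto simp: free_space_lookup lookup_point_vector)

text \<open>
  With \<open>D\<close> the common number of neighbours inside \<open>B\<close>, the normalisation makes this the
  identity element of the span of \<open>B\<close>.
\<close>

definition scaled_sum :: "'f::field \<Rightarrow> 'p set \<Rightarrow> nat \<Rightarrow> ('p \<Rightarrow>\<^sub>0 'f)" where
  "scaled_sum \<alpha> B D = point_vector B (\<lambda>_. 1 / (1 + \<alpha> / 2 * of_nat D))"

text \<open>
  The part of the axioms of a Fischer space that makes third points well defined, and with them the
  Matsuo algebra.
\<close>

locale triple_system =
  fixes G :: "'p point_line_space"
  assumes finite_points: "finite (points G)"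
    and line_in_points: "l \<in> lines G \<Longrightarrow> l \<subseteq> points G"
    and line_triple: "\<lbrakk>l \<in> lines G; x \<in> l; y \<in> l; x \<noteq> y\<rbrakk> \<Longrightarrow> \<exists>z. z \<noteq> x \<and> z \<noteq> y \<and> l = {x, y, z}"
    and line_unique: "\<lbrakk>l \<in> lines G; l' \<in> lines G; x \<noteq> y; x \<in> l; y \<in> l; x \<in> l'; y \<in> l'\<rbrakk> \<Longrightarrow> l = l'"
begin

lemma third_point_eq:
  assumes "{x, y, z} \<in> lines G" "x \<noteq> y" "z \<noteq> x" "z \<noteq> y"
  shows "third_point G x y = z"
  unfolding third_point_def
proof (rule the_equality)
  fix z' assume z': "z' \<noteq> x \<and> z' \<noteq> y \<and> {x, y, z'} \<in> lines G"
  then have "{x, y, z'} = {x, y, z}"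
    using line_unique[of "{x, y, z'}" "{x, y, z}" x y] assms by auto
  with z' show "z' = z" by auto
qed (use assms in auto)

lemma collinearE:
  assumes "collinear G x y"
  obtains z where "x \<noteq> y" "z \<noteq> x" "z \<noteq> y" "{x, y, z} \<in> lines G" "third_point G x y = z"
proof -
  obtain l where l: "x \<noteq> y" "l \<in> lines G" "x \<in> l" "y \<in> l"
    using assms by (auto simp: collinear_def)
  then obtain z where z: "z \<noteq> x" "z \<noteq> y" "l = {x, y, z}"
    using line_triple by blast
  with l show thesis
    using that third_point_eq by metis
qed

lemma collinear_sym: "collinear G x y \<longleftrightarrow> collinear G y x"
  by (auto simp: collinear_def)

lemma collinear_points: "collinear G x y \<Longrightarrow> x \<in> points G \<and> y \<in> points G"
  using line_in_points by (auto simp: collinear_def)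

lemma third_point_collinear:
  assumes "collinear G x y"
  shows "collinear G x (third_point G x y)" "collinear G y (third_point G x y)"
proof -
  from assms obtain z where "x \<noteq> y" "z \<noteq> x" "z \<noteq> y" "{x, y, z} \<in> lines G" "third_point G x y = z"
    by (rule collinearE)
  then show "collinear G x (third_point G x y)" "collinear G y (third_point G x y)"
    unfolding collinear_def by (auto intro!: bexI[of _ "{x, y, z}"])
qed

lemma third_point_sym:
  assumes "collinear G x y" shows "third_point G y x = third_point G x y"
proof -
  from assms obtain z where "x \<noteq> y" "z \<noteq> x" "z \<noteq> y" "{x, y, z} \<in> lines G" "third_point G x y = z"
    by (rule collinearE)
  then show ?thesis
    using third_point_eq[of y x z] by (simp add: insert_commute)
qed

lemma third_point_involution:
  assumes "collinear G x y"
  shows "third_point G x (third_point G x y) = y"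
proof -
  from assms obtain z where "x \<noteq> y" "z \<noteq> x" "z \<noteq> y" "{x, y, z} \<in> lines G" "third_point G x y = z"
    by (rule collinearE)
  then show ?thesis
    using third_point_eq[of x z y] by (auto simp: insert_commute)
qed

text \<open>
  Lets a sum over the pairs with third point \<open>z\<close> be indexed by the neighbours of \<open>z\<close>.
\<close>

lemma collinear_third_eq_iff:
  "collinear G x y \<and> third_point G x y = z \<longleftrightarrow> collinear G x z \<and> y = third_point G x z"
  using third_point_collinear(1) third_point_involution by metis

definition nbrs :: "'p \<Rightarrow> 'p set" where
  "nbrs z = {y. collinear G y z}"

lemma nbrs_points: "nbrs z \<subseteq> points G"
  using collinear_points by (auto simp: nbrs_def)

lemma finite_nbrs [simp]: "finite (nbrs z)"
  using nbrs_points finite_points finite_subset by blast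

lemma third_point_nbrs:
  assumes "y \<in> nbrs z"
  shows "third_point G y z \<in> nbrs z" "third_point G (third_point G y z) z = y"
proof -
  have yz: "collinear G z y" using assms by (simp add: nbrs_def collinear_sym)
  have sym: "third_point G y z = third_point G z y" using yz by (rule third_point_sym)
  have col: "collinear G z (third_point G z y)" using yz by (rule third_point_collinear)
  then show "third_point G y z \<in> nbrs z"
    using sym by (simp add: nbrs_def collinear_sym)
  show "third_point G (third_point G y z) z = y"
    using sym third_point_sym[OF col] third_point_involution[OF yz] by simp
qed

lemma bij_betw_third_point: "bij_betw (\<lambda>y. third_point G y z) (nbrs z) (nbrs z)"
  by (rule bij_betw_byWitness[where f' = "\<lambda>y. third_point G y z"])
     (auto simp: third_point_nbrs)

lemma sum_points_collinear:
  fixes h :: "'p \<Rightarrow> 'a::comm_monoid_add"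
  shows "(\<Sum>y\<in>points G. if collinear G y z then h y else 0) = sum h (nbrs z)"
proof -
  have "points G \<inter> {y. collinear G y z} = nbrs z"
    using nbrs_points by (auto simp: nbrs_def)
  then show ?thesis
    using sum.inter_restrict[OF finite_points, of h "{y. collinear G y z}"] by simp
qed

lemma sum_points_collinear':
  fixes h :: "'p \<Rightarrow> 'a::comm_monoid_add"
  shows "(\<Sum>y\<in>points G. if collinear G z y then h y else 0) = sum h (nbrs z)"
proof -
  have "collinear G z = (\<lambda>y. collinear G y z)"
    using collinear_sym by blast
  then show ?thesis by (simp add: sum_points_collinear)
qed

lemma lookup_matsuo_point_mult:
  fixes \<alpha> :: "'f::field"
  shows "Poly_Mapping.lookup (matsuo_point_mult \<alpha> G x y) z =
    of_bool (x = y \<and> x = z)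
    + \<alpha> / 2 * (of_bool (collinear G x y \<and> x = z) + of_bool (collinear G x y \<and> y = z)
      - of_bool (collinear G x y \<and> third_point G x y = z))"
  by (auto simp: matsuo_point_mult_def lookup_single when_def lookup_add lookup_minus collinear_def)

text \<open>
  All later computations use this coordinate form of the product. The last term collects the pairs
  whose third point is \<open>z\<close>: such a pair consists of a neighbour \<open>y\<close> of \<open>z\<close> and of the point \<open>y \<and> z\<close>.
\<close>

lemma lookup_matsuo_mult:
  fixes \<alpha> :: "'f::field"
  assumes u: "u \<in> free_space (points G)" and v: "v \<in> free_space (points G)"
    and z: "z \<in> points G"
  defines "U \<equiv> Poly_Mapping.lookup u" and "V \<equiv> Poly_Mapping.lookup v"
  shows "Poly_Mapping.lookup (matsuo_mult \<alpha> G u v) z =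
    U z * V z + \<alpha> / 2 * (\<Sum>y\<in>nbrs z. U z * V y + U y * V z - U y * V (third_point G y z))"
proof -
  let ?P = "points G"
  note [simp] = finite_points
  have U0: "U x = 0" if "x \<notin> Poly_Mapping.keys u" for x
    using that by (simp add: U_def in_keys_iff)
  have V0: "V x = 0" if "x \<notin> Poly_Mapping.keys v" for x
    using that by (simp add: V_def in_keys_iff)
  let ?c = "\<lambda>x y. Poly_Mapping.lookup (matsuo_point_mult \<alpha> G x y) z"
  have "Poly_Mapping.lookup (matsuo_mult \<alpha> G u v) z =
      (\<Sum>x\<in>Poly_Mapping.keys u. \<Sum>y\<in>Poly_Mapping.keys v. U x * V y * ?c x y)"
    by (simp add: matsuo_mult_def lookup_sum U_def V_def)
  also have "\<dots> = (\<Sum>x\<in>Poly_Mapping.keys u. \<Sum>y\<in>?P. U x * V y * ?c x y)"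
    by (intro sum.cong refl sum.mono_neutral_left)
       (use v V0 in \<open>auto simp: free_space_def\<close>)
  also have "\<dots> = (\<Sum>x\<in>?P. \<Sum>y\<in>?P. U x * V y * ?c x y)"
    by (intro sum.mono_neutral_left) (use u U0 in \<open>auto simp: free_space_def\<close>)
  also have "\<dots> = (\<Sum>x\<in>?P. \<Sum>y\<in>?P. U x * V y * of_bool (x = y \<and> x = z))
     + \<alpha> / 2 * ((\<Sum>x\<in>?P. \<Sum>y\<in>?P. U x * V y * of_bool (collinear G x y \<and> x = z))
       + (\<Sum>x\<in>?P. \<Sum>y\<in>?P. U x * V y * of_bool (collinear G x y \<and> y = z))
       - (\<Sum>x\<in>?P. \<Sum>y\<in>?P. U x * V y * of_bool (collinear G x y \<and> third_point G x y = z)))"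
    by (simp add: lookup_matsuo_point_mult sum.distrib sum_subtractf sum_distrib_left
        algebra_simps)
  also have "(\<Sum>x\<in>?P. \<Sum>y\<in>?P. U x * V y * of_bool (x = y \<and> x = z)) = U z * V z"
  proof -
    have "(\<Sum>x\<in>?P. \<Sum>y\<in>?P. U x * V y * of_bool (x = y \<and> x = z)) =
      (\<Sum>x\<in>?P. if x = z then \<Sum>y\<in>?P. (if y = z then U x * V y else 0) else 0)"
      by (intro sum.cong refl) (auto intro!: sum.cong sum.neutral)
    then show ?thesis using z by simp
  qed
  also have "(\<Sum>x\<in>?P. \<Sum>y\<in>?P. U x * V y * of_bool (collinear G x y \<and> x = z)) =
      (\<Sum>y\<in>nbrs z. U z * V y)"
  proof -
    have "U x * V y * of_bool (collinear G x y \<and> x = z) =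
        (if x = z then if collinear G z y then U z * V y else 0 else 0)" for x y
      by auto
    then show ?thesis
      using z by (simp only:) (subst sum.swap, simp add: sum_points_collinear')
  qed
  also have "(\<Sum>x\<in>?P. \<Sum>y\<in>?P. U x * V y * of_bool (collinear G x y \<and> y = z)) =
      (\<Sum>y\<in>nbrs z. U y * V z)"
  proof -
    have "(\<Sum>x\<in>?P. \<Sum>y\<in>?P. U x * V y * of_bool (collinear G x y \<and> y = z)) =
      (\<Sum>x\<in>?P. \<Sum>y\<in>?P. if y = z then (if collinear G x z then U x * V z else 0) else 0)"
      by (intro sum.cong refl) auto
    then show ?thesis using z by (simp add: sum_points_collinear)
  qed
  also have "(\<Sum>x\<in>?P. \<Sum>y\<in>?P. U x * V y * of_bool (collinear G x y \<and> third_point G x y = z)) =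
      (\<Sum>y\<in>nbrs z. U y * V (third_point G y z))"
  proof -
    have "(\<Sum>x\<in>?P. \<Sum>y\<in>?P. U x * V y * of_bool (collinear G x y \<and> third_point G x y = z)) =
      (\<Sum>x\<in>?P. \<Sum>y\<in>?P. if y = third_point G x z then (if collinear G x z then U x * V y else 0) else 0)"
      by (intro sum.cong refl) (auto simp: collinear_third_eq_iff)
    also have "\<dots> = (\<Sum>x\<in>?P. if collinear G x z then U x * V (third_point G x z) else 0)"
    proof (intro sum.cong refl)
      fix x
      show "(\<Sum>y\<in>?P. if y = third_point G x z then (if collinear G x z then U x * V y else 0) else 0)
        = (if collinear G x z then U x * V (third_point G x z) else 0)"
        using third_point_collinear[of x z] collinear_points by (simp, blast)
    qed
    finally show ?thesis by (simp add: sum_points_collinear)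
  qed
  finally show ?thesis
    by (simp add: sum.distrib sum_subtractf)
qed

lemma matsuo_mult_closed:
  fixes \<alpha> :: "'f::field"
  assumes u: "u \<in> free_space (points G)" and v: "v \<in> free_space (points G)"
  shows "matsuo_mult \<alpha> G u v \<in> free_space (points G)"
  unfolding free_space_lookup
proof (intro allI impI)
  fix z assume z: "z \<notin> points G"
  have "Poly_Mapping.lookup (matsuo_point_mult \<alpha> G x y) z = 0"
    if "x \<in> points G" "y \<in> points G" for x y
    using that z collinear_points third_point_collinear(1)[of x y]
    by (auto simp: lookup_matsuo_point_mult)
  then show "Poly_Mapping.lookup (matsuo_mult \<alpha> G u v) z = 0"
    using u v by (auto simp: matsuo_mult_def lookup_sum free_space_def subset_iff intro!: sum.neutral)
qed

lemma free_space_eqI: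
  assumes "u \<in> free_space S" "v \<in> free_space S"
    and "\<And>z. z \<in> S \<Longrightarrow> Poly_Mapping.lookup u z = Poly_Mapping.lookup v z"
  shows "u = v"
  using assms by (intro poly_mapping_eqI) (metis free_space_lookup)

lemma diff_in_free_space:
  fixes u v :: "'p \<Rightarrow>\<^sub>0 'f::ab_group_add"
  shows "u \<in> free_space S \<Longrightarrow> v \<in> free_space S \<Longrightarrow> u - v \<in> free_space S"
  by (auto simp: free_space_lookup lookup_minus)

lemma matsuo_mult_diff:
  fixes \<alpha> :: "'f::field"
  assumes "u \<in> free_space (points G)" "u' \<in> free_space (points G)" "v \<in> free_space (points G)"
  shows "matsuo_mult \<alpha> G (u - u') v = matsuo_mult \<alpha> G u v - matsuo_mult \<alpha> G u' v"
    and "matsuo_mult \<alpha> G v (u - u') = matsuo_mult \<alpha> G v u - matsuo_mult \<alpha> G v u'"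
  by (rule free_space_eqI[of _ "points G"];
      simp add: assms diff_in_free_space matsuo_mult_closed lookup_matsuo_mult lookup_minus
        sum.distrib sum_subtractf sum_distrib_left algebra_simps)+

text \<open>
  Only the third-point term is not visibly symmetric; the involution \<open>y \<mapsto> y \<and> z\<close> on the
  neighbours of \<open>z\<close> exchanges its two factors.
\<close>

lemma matsuo_mult_commute:
  fixes \<alpha> :: "'f::field"
  assumes "u \<in> free_space (points G)" "v \<in> free_space (points G)"
  shows "matsuo_mult \<alpha> G u v = matsuo_mult \<alpha> G v u"
proof (rule free_space_eqI[of _ "points G"])
  fix z assume z: "z \<in> points G"
  let ?U = "Poly_Mapping.lookup u" and ?V = "Poly_Mapping.lookup v"
  have "(\<Sum>y\<in>nbrs z. ?U y * ?V (third_point G y z)) =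
      (\<Sum>y\<in>nbrs z. ?U (third_point G y z) * ?V (third_point G (third_point G y z) z))"
    by (rule sum.reindex_bij_betw[OF bij_betw_third_point, symmetric])
  also have "\<dots> = (\<Sum>y\<in>nbrs z. ?V y * ?U (third_point G y z))"
  proof (intro sum.cong refl)
    fix y assume "y \<in> nbrs z"
    then show "?U (third_point G y z) * ?V (third_point G (third_point G y z) z) = ?V y * ?U (third_point G y z)"
      by (simp add: third_point_nbrs)
  qed
  finally show "Poly_Mapping.lookup (matsuo_mult \<alpha> G u v) z = Poly_Mapping.lookup (matsuo_mult \<alpha> G v u) z"
    using z assms by (simp add: lookup_matsuo_mult sum.distrib sum_subtractf algebra_simps)
qed (use assms matsuo_mult_closed in auto)

lemma matsuo_form_eq:
  fixes \<alpha> c :: "'f::field"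
  assumes u: "u \<in> free_space (points G)" and v: "v \<in> free_space (points G)"
  defines "U \<equiv> Poly_Mapping.lookup u" and "V \<equiv> Poly_Mapping.lookup v"
  shows "matsuo_form \<alpha> c G u v =
    (\<Sum>x\<in>points G. U x * (2 * c * V x + c * \<alpha> * (\<Sum>y\<in>nbrs x. V y)))"
proof -
  let ?P = "points G"
  note [simp] = finite_points
  have U0: "U x = 0" if "x \<notin> Poly_Mapping.keys u" for x
    using that by (simp add: U_def in_keys_iff)
  have V0: "V x = 0" if "x \<notin> Poly_Mapping.keys v" for x
    using that by (simp add: V_def in_keys_iff)
  have "matsuo_form \<alpha> c G u v = (\<Sum>x\<in>Poly_Mapping.keys u. \<Sum>y\<in>Poly_Mapping.keys v.
      U x * V y * matsuo_point_form \<alpha> c G x y)"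
    by (simp add: matsuo_form_def U_def V_def)
  also have "\<dots> = (\<Sum>x\<in>Poly_Mapping.keys u. \<Sum>y\<in>?P. U x * V y * matsuo_point_form \<alpha> c G x y)"
    by (intro sum.cong refl sum.mono_neutral_left)
       (use v V0 in \<open>auto simp: free_space_def\<close>)
  also have "\<dots> = (\<Sum>x\<in>?P. \<Sum>y\<in>?P. U x * V y * matsuo_point_form \<alpha> c G x y)"
    by (intro sum.mono_neutral_left) (use u U0 in \<open>auto simp: free_space_def\<close>)
  also have "\<dots> = (\<Sum>x\<in>?P. U x * (2 * c * V x + c * \<alpha> * (\<Sum>y\<in>nbrs x. V y)))"
  proof (intro sum.cong refl)
    fix x assume x: "x \<in> ?P"
    have "(\<Sum>y\<in>?P. U x * V y * matsuo_point_form \<alpha> c G x y) =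
      (\<Sum>y\<in>?P. (if y = x then U x * (2 * c * V y) else 0)
        + (if collinear G y x then U x * (c * \<alpha> * V y) else 0))"
      by (intro sum.cong refl) (auto simp: matsuo_point_form_def collinear_def)
    also have "\<dots> = U x * (2 * c * V x + c * \<alpha> * (\<Sum>y\<in>nbrs x. V y))"
      using x by (simp add: sum.distrib sum_points_collinear sum_distrib_left algebra_simps)
    finally show "(\<Sum>y\<in>?P. U x * V y * matsuo_point_form \<alpha> c G x y) = \<dots>" .
  qed
  finally show ?thesis .
qed

lemma matsuo_form_diff:
  fixes \<alpha> c :: "'f::field"
  assumes "u \<in> free_space (points G)" "u' \<in> free_space (points G)" "v \<in> free_space (points G)"
  shows "matsuo_form \<alpha> c G (u - u') v = matsuo_form \<alpha> c G u v - matsuo_form \<alpha> c G u' v"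
    and "matsuo_form \<alpha> c G v (u - u') = matsuo_form \<alpha> c G v u - matsuo_form \<alpha> c G v u'"
  using assms
  by (simp_all add: matsuo_form_eq diff_in_free_space lookup_minus sum.distrib sum_subtractf
      sum_distrib_left algebra_simps)

lemma matsuo_form_commute:
  "matsuo_form \<alpha> c G u v = matsuo_form \<alpha> c G v u"
  unfolding matsuo_form_def
  by (subst sum.swap) (intro sum.cong refl, auto simp: matsuo_point_form_def collinear_sym)

definition regular_subspace :: "'p set \<Rightarrow> nat \<Rightarrow> bool" where
  "regular_subspace B D \<longleftrightarrow> B \<subseteq> points G
    \<and> (\<forall>x\<in>B. \<forall>y\<in>B. collinear G x y \<longrightarrow> third_point G x y \<in> B)
    \<and> (\<forall>x\<in>B. card (nbrs x \<inter> B) = D)"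

context
  fixes \<alpha> :: "'f::field_char_0" and B D
  assumes reg: "regular_subspace B D" and nz: "1 + \<alpha> / 2 * of_nat D \<noteq> 0"
begin

lemma finite_subspace: "finite B"
  using reg finite_points finite_subset by (auto simp: regular_subspace_def)

lemma lookup_scaled_sum:
  "Poly_Mapping.lookup (scaled_sum \<alpha> B D) x = (if x \<in> B then 1 / (1 + \<alpha> / 2 * of_nat D) else 0)"
  by (simp add: scaled_sum_def lookup_point_vector finite_subspace)

lemma scaled_sum_in_free_space: "scaled_sum \<alpha> B D \<in> free_space B"
  by (auto simp: free_space_lookup lookup_scaled_sum)

lemma free_space_subspace: "free_space B \<subseteq> free_space (points G)"
  using reg by (auto simp: regular_subspace_def free_space_def)

lemma sum_nbrs_scaled_sum:
  assumes "z \<in> B"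
  shows "(\<Sum>y\<in>nbrs z. Poly_Mapping.lookup (scaled_sum \<alpha> B D) y) =
    of_nat D / (1 + \<alpha> / 2 * of_nat D)"
proof -
  have "(\<Sum>y\<in>nbrs z. Poly_Mapping.lookup (scaled_sum \<alpha> B D) y) =
      (\<Sum>y\<in>nbrs z \<inter> B. 1 / (1 + \<alpha> / 2 * of_nat D))"
    by (simp only: sum.inter_restrict[OF finite_nbrs] lookup_scaled_sum)
  also have "\<dots> = of_nat (card (nbrs z \<inter> B)) * (1 / (1 + \<alpha> / 2 * of_nat D))"
    by (rule sum_constant)
  finally show ?thesis
    using assms reg by (simp add: regular_subspace_def)
qed

text \<open>
  Let \<open>u\<close> be the scaled sum. Closedness of \<open>B\<close> makes a neighbour \<open>y\<close> in \<open>B\<close> contribute to the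
  coefficient at \<open>z\<close> through \<open>v y * (u z - u (y \<and> z))\<close> with \<open>z\<close> and \<open>y \<and> z\<close> both in \<open>B\<close> or both outside it, hence not at
  all. This leaves \<open>v z\<close> times the total of \<open>u z\<close> and \<open>\<alpha>/2\<close> times the sum of \<open>u\<close> over the neighbours of \<open>z\<close>.
\<close>

lemma scaled_sum_mult:
  assumes v: "v \<in> free_space B"
  shows "matsuo_mult \<alpha> G v (scaled_sum \<alpha> B D) = v"
proof (rule free_space_eqI[of _ "points G"])
  let ?V = "Poly_Mapping.lookup v" and ?U = "Poly_Mapping.lookup (scaled_sum \<alpha> B D)"
  let ?q = "1 / (1 + \<alpha> / 2 * of_nat D)"
  have vP: "v \<in> free_space (points G)" and uP: "scaled_sum \<alpha> B D \<in> free_space (points G)"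
    using v free_space_subspace scaled_sum_in_free_space by auto
  show "matsuo_mult \<alpha> G v (scaled_sum \<alpha> B D) \<in> free_space (points G)" "v \<in> free_space (points G)"
    using vP uP matsuo_mult_closed by auto
  fix z assume z: "z \<in> points G"
  have V0: "?V x = 0" if "x \<notin> B" for x
    using v that by (auto simp: free_space_lookup)
  have third: "third_point G y z \<in> B \<longleftrightarrow> z \<in> B" if "y \<in> nbrs z" "y \<in> B" for y
    using that reg third_point_collinear(1)[of y z] third_point_involution[of y z]
    unfolding regular_subspace_def nbrs_def by (metis mem_Collect_eq)
  have eq: "Poly_Mapping.lookup (matsuo_mult \<alpha> G v (scaled_sum \<alpha> B D)) z =
      ?V z * ?U z + \<alpha> / 2 * (\<Sum>y\<in>nbrs z. ?V z * ?U y + ?V y * ?U z - ?V y * ?U (third_point G y z))"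
    using vP uP z by (rule lookup_matsuo_mult)
  have "?V y * ?U z - ?V y * ?U (third_point G y z) = 0" if "y \<in> nbrs z" for y
    using V0[of y] third[OF that] by (cases "y \<in> B") (auto simp: lookup_scaled_sum)
  then have "(\<Sum>y\<in>nbrs z. ?V z * ?U y + ?V y * ?U z - ?V y * ?U (third_point G y z)) =
     (\<Sum>y\<in>nbrs z. ?V z * ?U y)"
    by (intro sum.cong refl) (metis add.right_neutral add_diff_eq)
  also have "\<dots> = ?V z * (\<Sum>y\<in>nbrs z. ?U y)"
    by (simp add: sum_distrib_left)
  finally have eq2: "Poly_Mapping.lookup (matsuo_mult \<alpha> G v (scaled_sum \<alpha> B D)) z =
      ?V z * ?U z + \<alpha> / 2 * (?V z * (\<Sum>y\<in>nbrs z. ?U y))"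
    using eq by simp
  show "Poly_Mapping.lookup (matsuo_mult \<alpha> G v (scaled_sum \<alpha> B D)) z = ?V z"
  proof (cases "z \<in> B")
    case True
    have "Poly_Mapping.lookup (matsuo_mult \<alpha> G v (scaled_sum \<alpha> B D)) z =
        ?V z * ?q + \<alpha> / 2 * (?V z * (of_nat D * ?q))"
      unfolding eq2 sum_nbrs_scaled_sum[OF True] using True by (simp add: lookup_scaled_sum)
    also have "\<dots> = ?V z * ((1 + \<alpha> / 2 * of_nat D) * ?q)"
      by (simp only: distrib_left distrib_right mult_1_left mult_1_right ac_simps)
    also have "\<dots> = ?V z" using nz by simp
    finally show ?thesis .
  next
    case False
    then show ?thesis by (simp add: eq2 V0)
  qed
qed

lemma is_identity_scaled_sum: "is_identity_of \<alpha> G (free_space B) (scaled_sum \<alpha> B D)"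
  unfolding is_identity_of_def
  using scaled_sum_in_free_space scaled_sum_mult free_space_subspace matsuo_mult_commute
  by (metis subsetD)

lemma identity_of_free_space: "identity_of \<alpha> G (free_space B) = scaled_sum \<alpha> B D"
  unfolding identity_of_def
proof (rule the_equality)
  show "is_identity_of \<alpha> G (free_space B) (scaled_sum \<alpha> B D)"
    by (rule is_identity_scaled_sum)
  fix e assume "is_identity_of \<alpha> G (free_space B) e"
  then show "e = scaled_sum \<alpha> B D"
    using is_identity_scaled_sum unfolding is_identity_of_def by metis
qed

text \<open>
  Every point of \<open>B\<close> has form value \<open>2 c\<close> with the identity of the span of \<open>B\<close>, the value of the form
  at the point itself; the form extends this linearly.
\<close>

lemma matsuo_form_scaled_sum:
  assumes u: "u \<in> free_space B"
  shows "matsuo_form \<alpha> c G u (scaled_sum \<alpha> B D) = 2 * c * (\<Sum>x\<in>B. Poly_Mapping.lookup u x)"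
proof -
  let ?U = "Poly_Mapping.lookup u" and ?E = "Poly_Mapping.lookup (scaled_sum \<alpha> B D)"
  let ?q = "1 / (1 + \<alpha> / 2 * of_nat D)"
  have "matsuo_form \<alpha> c G u (scaled_sum \<alpha> B D) =
     (\<Sum>x\<in>points G. ?U x * (2 * c * ?E x + c * \<alpha> * (\<Sum>y\<in>nbrs x. ?E y)))"
    using u free_space_subspace scaled_sum_in_free_space by (intro matsuo_form_eq) auto
  also have "\<dots> = (\<Sum>x\<in>B. ?U x * (2 * c * ?E x + c * \<alpha> * (\<Sum>y\<in>nbrs x. ?E y)))"
    by (rule sum.mono_neutral_right[OF finite_points])
       (use u reg in \<open>auto simp: free_space_lookup regular_subspace_def\<close>)
  also have "\<dots> = (\<Sum>x\<in>B. ?U x * (2 * c))"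
  proof (intro sum.cong refl)
    fix x assume x: "x \<in> B"
    have "?U x * (2 * c * ?E x + c * \<alpha> * (\<Sum>y\<in>nbrs x. ?E y)) =
        ?U x * (2 * c * ?q + c * \<alpha> * (of_nat D * ?q))"
      unfolding sum_nbrs_scaled_sum[OF x] using x by (simp add: lookup_scaled_sum)
    also have "2 * c * ?q + c * \<alpha> * (of_nat D * ?q) = 2 * c * ((1 + \<alpha> / 2 * of_nat D) * ?q)"
    proof -
      have "c * \<alpha> = 2 * c * (\<alpha> / 2)" by simp
      then show ?thesis
        by (simp only: distrib_left distrib_right mult_1_left mult_1_right ac_simps)
    qed
    also have "?U x * (2 * c * ((1 + \<alpha> / 2 * of_nat D) * ?q)) = ?U x * (2 * c)" using nz by simp
    finally show "?U x * (2 * c * ?E x + c * \<alpha> * (\<Sum>y\<in>nbrs x. ?E y)) = ?U x * (2 * c)" .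
  qed
  finally show ?thesis
    by (simp add: sum_distrib_right[symmetric] mult.commute)
qed

lemma matsuo_form_scaled_sum_self:
  "matsuo_form \<alpha> c G (scaled_sum \<alpha> B D) (scaled_sum \<alpha> B D) =
    2 * c * (of_nat (card B) / (1 + \<alpha> / 2 * of_nat D))"
  by (simp add: matsuo_form_scaled_sum scaled_sum_in_free_space lookup_scaled_sum)

end

context
  fixes \<alpha> :: "'f::field_char_0" and B D C E
  assumes B: "regular_subspace B D" "1 + \<alpha> / 2 * of_nat D \<noteq> 0"
    and C: "regular_subspace C E" "1 + \<alpha> / 2 * of_nat E \<noteq> 0"
    and BC: "B \<subseteq> C"
begin

lemma scaled_sum_in_larger: "scaled_sum \<alpha> B D \<in> free_space C"
  using scaled_sum_in_free_space[OF B] BC by (auto simp: free_space_def)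

lemma idempotent_diff_scaled_sum:
  "idempotent \<alpha> G (scaled_sum \<alpha> C E - scaled_sum \<alpha> B D)"
proof -
  let ?b = "scaled_sum \<alpha> B D" and ?c = "scaled_sum \<alpha> C E"
  have in_G: "?b \<in> free_space (points G)" "?c \<in> free_space (points G)"
    using scaled_sum_in_larger scaled_sum_in_free_space[OF C] free_space_subspace[OF C] by auto
  have "matsuo_mult \<alpha> G ?b ?c = ?b" "matsuo_mult \<alpha> G ?c ?c = ?c" "matsuo_mult \<alpha> G ?b ?b = ?b"
    using scaled_sum_mult[OF C] scaled_sum_mult[OF B] scaled_sum_in_larger
      scaled_sum_in_free_space[OF C] scaled_sum_in_free_space[OF B] by auto
  moreover have "matsuo_mult \<alpha> G ?c ?b = matsuo_mult \<alpha> G ?b ?c"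
    using in_G by (intro matsuo_mult_commute)
  ultimately show ?thesis
    using in_G by (simp add: idempotent_def diff_in_free_space matsuo_mult_diff)
qed

lemma central_charge_diff_scaled_sum:
  "central_charge \<alpha> c G (scaled_sum \<alpha> C E - scaled_sum \<alpha> B D) =
    c * (of_nat (card C) / (1 + \<alpha> / 2 * of_nat E) - of_nat (card B) / (1 + \<alpha> / 2 * of_nat D))"
proof -
  let ?b = "scaled_sum \<alpha> B D" and ?c = "scaled_sum \<alpha> C E"
  have in_G: "?b \<in> free_space (points G)" "?c \<in> free_space (points G)"
    using scaled_sum_in_larger scaled_sum_in_free_space[OF C] free_space_subspace[OF C] by auto
  have "(\<Sum>x\<in>C. Poly_Mapping.lookup ?b x) = (\<Sum>x\<in>B. Poly_Mapping.lookup ?b x)"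
    by (rule sum.mono_neutral_right[OF finite_subspace[OF C] BC])
       (auto simp: lookup_scaled_sum[OF B])
  then have "matsuo_form \<alpha> c G ?b ?c = matsuo_form \<alpha> c G ?b ?b"
    by (simp add: matsuo_form_scaled_sum[OF C] matsuo_form_scaled_sum[OF B] scaled_sum_in_larger
        scaled_sum_in_free_space[OF B])
  moreover have "matsuo_form \<alpha> c G ?c ?b = matsuo_form \<alpha> c G ?b ?c"
    by (rule matsuo_form_commute)
  ultimately show ?thesis
    using in_G by (simp add: central_charge_def diff_in_free_space matsuo_form_diff
        matsuo_form_scaled_sum_self[OF B] matsuo_form_scaled_sum_self[OF C] algebra_simps)
qed

end

end

section \<open>The doubled Fischer space of the symmetric group\<close>

text \<open>
  A transposition determines its pair of letters, so functions on points are functions on edges.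
\<close>

lemma transpose_eq_iff:
  assumes "a \<noteq> b"
  shows "transpose a b = transpose c d \<longleftrightarrow> (a = c \<and> b = d) \<or> (a = d \<and> b = c)"
proof
  assume eq: "transpose a b = transpose c d"
  have "transpose c d a = b" "transpose c d b = a"
    unfolding eq[symmetric] by simp_all
  with assms show "(a = c \<and> b = d) \<or> (a = d \<and> b = c)"
    by (auto simp: transpose_def split: if_splits)
qed (auto simp: transpose_commute)

text \<open>
  The third transposition on a line is the conjugate of one by the other. This
  expresses it by the two points alone and so gives uniqueness of lines.
\<close>

lemma sym_line:
  assumes l: "l \<in> lines (sym_space j)" and xy: "x \<in> l" "y \<in> l" "x \<noteq> y"
  shows "l = {x, y, x \<circ> y \<circ> x} \<and> x \<circ> y \<circ> x \<noteq> x \<and> x \<circ> y \<circ> x \<noteq> y"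
proof -
  obtain a b d where abd: "a \<noteq> b" "b \<noteq> d" "a \<noteq> d"
    and l_eq: "l = {transpose a b, transpose b d, transpose a d}"
    using l by (auto simp: sym_space_def)
  note ne = transpose_eq_iff
  have c: "transpose a b \<circ> transpose b d \<circ> transpose a b = transpose a d"
    "transpose a b \<circ> transpose a d \<circ> transpose a b = transpose b d"
    "transpose b d \<circ> transpose a b \<circ> transpose b d = transpose a d"
    "transpose b d \<circ> transpose a d \<circ> transpose b d = transpose a b"
    "transpose a d \<circ> transpose a b \<circ> transpose a d = transpose b d"
    "transpose a d \<circ> transpose b d \<circ> transpose a d = transpose a b"
    using abd by (auto simp: fun_eq_iff transpose_def)
  show ?thesis
    using xy abd unfolding l_eq by (auto simp: c ne)
qed

lemma finite_sym_points: "finite (points (sym_space j))"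
proof -
  have "points (sym_space j) \<subseteq> (\<lambda>(a, b). transpose a b) ` ({1..j+1} \<times> {1..j+1})"
    by (auto simp: sym_space_def)
  then show ?thesis by (rule finite_subset) auto
qed

lemma triple_system_sym_space: "triple_system (sym_space j)"
proof
  show "finite (points (sym_space j))" by (rule finite_sym_points)
  show "l \<subseteq> points (sym_space j)" if "l \<in> lines (sym_space j)" for l
    using that by (auto simp: sym_space_def)
  show "\<exists>z. z \<noteq> x \<and> z \<noteq> y \<and> l = {x, y, z}"
    if "l \<in> lines (sym_space j)" "x \<in> l" "y \<in> l" "x \<noteq> y" for l x y
    using sym_line[OF that] by auto
  show "l = l'" if "l \<in> lines (sym_space j)" "l' \<in> lines (sym_space j)" "x \<noteq> y"
    "x \<in> l" "y \<in> l" "x \<in> l'" "y \<in> l'" for l l' x y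
    using sym_line[OF that(1,4,5,3)] sym_line[OF that(2,6,7,3)] by simp
qed

context triple_system
begin

text \<open>
  The sign rule \<open>(\<epsilon>, \<eta>) \<mapsto> \<epsilon> \<eta>\<close> is symmetric in the three points of a line, the product of all
  three signs being \<open>1\<close>. So any two points of a line of the double may serve as the
  generating pair.
\<close>

lemma line_double:
  assumes l: "l \<in> lines (double_space G)"
    and xy: "(x, \<epsilon>) \<in> l" "(y, \<eta>) \<in> l" "(x, \<epsilon>) \<noteq> (y, \<eta>)"
  shows "collinear G x y \<and> \<epsilon> \<in> {1, -1} \<and> \<eta> \<in> {1, -1}
    \<and> l = {(x, \<epsilon>), (y, \<eta>), (third_point G x y, \<epsilon> * \<eta>)}"
proof -
  obtain p q :: 'p and s t :: int where pq: "collinear G p q" "s \<in> {1, -1}" "t \<in> {1, -1}"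
    and l_eq: "l = {(p, s), (q, t), (third_point G p q, s * t)}"
    using l by (auto simp: double_space_def)
  let ?r = "third_point G p q"
  have col: "collinear G q p" "collinear G p ?r" "collinear G q ?r" "collinear G ?r p" "collinear G ?r q"
    using pq(1) third_point_collinear collinear_sym by blast+
  have tp: "third_point G q p = ?r" "third_point G p ?r = q" "third_point G ?r p = q"
    "third_point G q ?r = p" "third_point G ?r q = p"
    using third_point_sym third_point_involution pq(1) col by metis+
  consider "(x, \<epsilon>) = (p, s)" "(y, \<eta>) = (q, t)" | "(x, \<epsilon>) = (p, s)" "(y, \<eta>) = (?r, s * t)"
    | "(x, \<epsilon>) = (q, t)" "(y, \<eta>) = (p, s)" | "(x, \<epsilon>) = (q, t)" "(y, \<eta>) = (?r, s * t)"
    | "(x, \<epsilon>) = (?r, s * t)" "(y, \<eta>) = (p, s)" | "(x, \<epsilon>) = (?r, s * t)" "(y, \<eta>) = (q, t)"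
    using xy unfolding l_eq by (elim insertE emptyE) simp_all
  then show ?thesis
    by cases (use pq(2,3) in \<open>auto simp: l_eq pq(1) col tp insert_commute\<close>)
qed

lemma collinear_double:
  "collinear (double_space G) (x, \<epsilon>) (y, \<eta>) \<longleftrightarrow>
    collinear G x y \<and> \<epsilon> \<in> {1, -1} \<and> \<eta> \<in> {1, -1}"
proof
  assume "collinear (double_space G) (x, \<epsilon>) (y, \<eta>)"
  then show "collinear G x y \<and> \<epsilon> \<in> {1, -1} \<and> \<eta> \<in> {1, -1}"
    unfolding collinear_def[of "double_space G"] using line_double by blast
next
  assume a: "collinear G x y \<and> \<epsilon> \<in> {1, -1} \<and> \<eta> \<in> {1, -1}"
  then have "{(x, \<epsilon>), (y, \<eta>), (third_point G x y, \<epsilon> * \<eta>)} \<in> lines (double_space G)"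
    using collinear_points[of x y] by (auto simp: double_space_def)
  moreover have "x \<noteq> y" using a by (auto simp: collinear_def)
  ultimately show "collinear (double_space G) (x, \<epsilon>) (y, \<eta>)"
    unfolding collinear_def[of "double_space G"] by blast
qed

lemma triple_system_double_space: "triple_system (double_space G)"
proof
  show "finite (points (double_space G))"
    using finite_points by (simp add: double_space_def)
  fix l assume l: "l \<in> lines (double_space G)"
  then obtain p q :: 'p and s t :: int where pq: "collinear G p q" "s \<in> {1, -1}" "t \<in> {1, -1}"
    and l_eq: "l = {(p, s), (q, t), (third_point G p q, s * t)}"
    by (auto simp: double_space_def)
  show "l \<subseteq> points (double_space G)"
    using pq collinear_points third_point_collinear(1)[OF pq(1)] by (auto simp: l_eq double_space_def)
  fix x y assume xy: "x \<in> l" "y \<in> l" "x \<noteq> y"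
  obtain x' y' \<epsilon> \<eta> where xy': "x = (x', \<epsilon>)" "y = (y', \<eta>)" by (meson surj_pair)
  have *: "collinear G x' y'"
      "l = {x, y, (third_point G x' y', \<epsilon> * \<eta>)}"
    using line_double[OF l, of x' \<epsilon> y' \<eta>] xy xy' by auto
  moreover have "third_point G x' y' \<noteq> x'" "third_point G x' y' \<noteq> y'"
    using *(1) by (auto elim: collinearE)
  ultimately show "\<exists>z. z \<noteq> x \<and> z \<noteq> y \<and> l = {x, y, z}"
    using xy' by (intro exI[of _ "(third_point G x' y', \<epsilon> * \<eta>)"]) auto
  fix l' assume l': "l' \<in> lines (double_space G)" "x \<in> l'" "y \<in> l'"
  then show "l = l'"
    using line_double[OF l'(1), of x' \<epsilon> y' \<eta>] *(2) xy xy' by auto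
qed

lemma third_point_double:
  assumes "collinear (double_space G) (x, \<epsilon>) (y, \<eta>)"
  shows "third_point (double_space G) (x, \<epsilon>) (y, \<eta>) = (third_point G x y, \<epsilon> * \<eta>)"
proof -
  interpret D: triple_system "double_space G" by (rule triple_system_double_space)
  obtain l where l: "l \<in> lines (double_space G)" "(x, \<epsilon>) \<in> l" "(y, \<eta>) \<in> l" "(x, \<epsilon>) \<noteq> (y, \<eta>)"
    using assms by (auto simp: collinear_def)
  have *: "collinear G x y" "l = {(x, \<epsilon>), (y, \<eta>), (third_point G x y, \<epsilon> * \<eta>)}"
    using line_double[OF l] by auto
  moreover have "third_point G x y \<noteq> x" "third_point G x y \<noteq> y"
    using *(1) by (auto elim: collinearE)
  ultimately show ?thesis
    using l by (intro D.third_point_eq) auto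
qed

end

lemma collinear_transpose:
  assumes ab: "a \<in> {1..n+1}" "b \<in> {1..n+1}" "a \<noteq> b"
  shows "collinear (sym_space n) y (transpose a b) \<longleftrightarrow>
    (\<exists>d\<in>{1..n+1} - {a, b}. y = transpose a d \<or> y = transpose b d)"
proof
  assume "collinear (sym_space n) y (transpose a b)"
  then obtain p q r where pqr: "p \<in> {1..n+1}" "q \<in> {1..n+1}" "r \<in> {1..n+1}" "p \<noteq> q" "q \<noteq> r" "p \<noteq> r"
    and in_line: "y \<in> {transpose p q, transpose q r, transpose p r}"
      "transpose a b \<in> {transpose p q, transpose q r, transpose p r}" "y \<noteq> transpose a b"
    by (auto simp: collinear_def sym_space_def)
  from in_line(2) consider "{a, b} = {p, q}" | "{a, b} = {q, r}" | "{a, b} = {p, r}"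
    using ab(3) by (auto simp: transpose_eq_iff)
  then show "\<exists>d\<in>{1..n+1} - {a, b}. y = transpose a d \<or> y = transpose b d"
  proof cases
    case 1 with in_line(1,3) pqr show ?thesis
      by (intro bexI[of _ r]) (auto simp: doubleton_eq_iff transpose_commute)
  next
    case 2 with in_line(1,3) pqr show ?thesis
      by (intro bexI[of _ p]) (auto simp: doubleton_eq_iff transpose_commute)
  next
    case 3 with in_line(1,3) pqr show ?thesis
      by (intro bexI[of _ q]) (auto simp: doubleton_eq_iff transpose_commute)
  qed
next
  assume "\<exists>d\<in>{1..n+1} - {a, b}. y = transpose a d \<or> y = transpose b d"
  then obtain d where d: "d \<in> {1..n+1}" "d \<noteq> a" "d \<noteq> b" "y = transpose a d \<or> y = transpose b d"
    by blast
  let ?l = "{transpose a b, transpose b d, transpose a d}"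
  have "?l \<in> lines (sym_space n)"
    using ab d by (auto simp: sym_space_def)
  moreover have "y \<in> ?l" "transpose a b \<in> ?l"
    using d by auto
  moreover have "y \<noteq> transpose a b"
    using d ab by (auto simp: transpose_eq_iff)
  ultimately show "collinear (sym_space n) y (transpose a b)"
    unfolding collinear_def by (intro conjI bexI[where x = ?l])
qed

lemma third_point_transpose:
  assumes "a \<in> {1..n+1}" "b \<in> {1..n+1}" "d \<in> {1..n+1}" "a \<noteq> b" "d \<noteq> a" "d \<noteq> b"
  shows "third_point (sym_space n) (transpose a d) (transpose a b) = transpose b d"
proof -
  interpret triple_system "sym_space n" by (rule triple_system_sym_space)
  have "{transpose d a, transpose a b, transpose d b} \<in> lines (sym_space n)"
    using assms by (auto simp: sym_space_def)
  then show ?thesis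
    using assms by (intro third_point_eq) (auto simp: transpose_eq_iff transpose_commute)
qed

lemma sum_neighbours_double_sym:
  fixes h :: "(nat \<Rightarrow> nat) \<times> int \<Rightarrow> 'a::comm_monoid_add"
  assumes ab: "a \<in> {1..n+1}" "b \<in> {1..n+1}" "a \<noteq> b" and \<epsilon>: "\<epsilon> \<in> {1, -1}"
  shows "sum h (triple_system.nbrs (double_sym_space n) (transpose a b, \<epsilon>)) =
    (\<Sum>d\<in>{1..n+1} - {a, b}. \<Sum>\<delta>\<in>{1, -1}. h (transpose a d, \<delta>) + h (transpose b d, \<delta>))"
proof -
  interpret S: triple_system "sym_space n" by (rule triple_system_sym_space)
  interpret D: triple_system "double_sym_space n" by (rule S.triple_system_double_space)
  let ?N = "{1..n+1} - {a, b}"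
  have nb: "D.nbrs (transpose a b, \<epsilon>) =
      (\<lambda>(d, \<delta>). (transpose a d, \<delta>)) ` (?N \<times> {1, -1}) \<union> (\<lambda>(d, \<delta>). (transpose b d, \<delta>)) ` (?N \<times> {1, -1})"
    (is "_ = ?A \<union> ?B")
  proof (intro set_eqI)
    fix p :: "(nat \<Rightarrow> nat) \<times> int"
    obtain y \<delta> where p: "p = (y, \<delta>)" by (cases p)
    have in_nbrs: "p \<in> D.nbrs (transpose a b, \<epsilon>) \<longleftrightarrow>
        (\<exists>d\<in>?N. y = transpose a d \<or> y = transpose b d) \<and> \<delta> \<in> {1, -1}"
      using \<epsilon> unfolding D.nbrs_def p mem_Collect_eq S.collinear_double collinear_transpose[OF ab]
      by blast
    have in_image: "(p \<in> (\<lambda>(d, \<delta>). (transpose c d, \<delta>)) ` (?N \<times> {1, -1})) \<longleftrightarrow>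
        (\<exists>d\<in>?N. y = transpose c d) \<and> \<delta> \<in> {1, -1}" for c
      unfolding p by (auto simp del: atLeastAtMost_iff)
    show "p \<in> D.nbrs (transpose a b, \<epsilon>) \<longleftrightarrow> p \<in> ?A \<union> ?B"
      unfolding Un_iff in_nbrs in_image by blast
  qed
  have disj: "?A \<inter> ?B = {}"
    using ab by (auto simp: transpose_eq_iff)
  have inj: "inj_on (\<lambda>(d, \<delta>). (transpose c d, \<delta>)) (?N \<times> {1, -1::int})" if "c \<in> {a, b}" for c
    using that by (auto simp: inj_on_def transpose_eq_iff)
  have "sum h (D.nbrs (transpose a b, \<epsilon>)) = sum h ?A + sum h ?B"
    unfolding nb by (rule sum.union_disjoint[OF _ _ disj]) auto
  also have "sum h ?A = (\<Sum>(d, \<delta>)\<in>?N \<times> {1, -1}. h (transpose a d, \<delta>))"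
    by (subst sum.reindex[OF inj]) (auto intro!: sum.cong)
  also have "sum h ?B = (\<Sum>(d, \<delta>)\<in>?N \<times> {1, -1}. h (transpose b d, \<delta>))"
    by (subst sum.reindex[OF inj]) (auto intro!: sum.cong)
  finally show ?thesis
    by (simp add: sum.cartesian_product[symmetric] sum.distrib del: sum.insert)
qed

lemma triple_system_double_sym_space: "triple_system (double_sym_space n)"
  by (intro triple_system.triple_system_double_space triple_system_sym_space)

lemma transpose_in_sym_points:
  "a \<noteq> b \<Longrightarrow> transpose a b \<in> points (sym_space j) \<longleftrightarrow> a \<in> {1..j+1} \<and> b \<in> {1..j+1}"
  by (auto simp: sym_space_def transpose_eq_iff)

lemma double_sym_pointE:
  assumes "z \<in> points (double_sym_space n)"
  obtains a b \<epsilon> where "a \<in> {1..n+1}" "b \<in> {1..n+1}" "a \<noteq> b" "\<epsilon> \<in> {1, -1}" "z = (transpose a b, \<epsilon>)"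
  using assms by (auto simp: double_space_def sym_space_def)

lemma in_double_sym_points:
  "a \<noteq> b \<Longrightarrow> (transpose a b, \<epsilon>) \<in> points (double_sym_space n) \<longleftrightarrow>
    a \<in> {1..n+1} \<and> b \<in> {1..n+1} \<and> \<epsilon> \<in> {1, -1}"
  using transpose_in_sym_points[of a b n] by (auto simp: double_space_def)

lemma third_point_closed_sym_points:
  assumes "x \<in> points (sym_space j)" "y \<in> points (sym_space j)" "collinear (sym_space n) y x" "j \<le> n"
  shows "third_point (sym_space n) y x \<in> points (sym_space j)"
proof -
  obtain a b where ab: "x = transpose a b" "a \<in> {1..j+1}" "b \<in> {1..j+1}" "a \<noteq> b"
    using assms(1) by (auto simp: sym_space_def)
  have ab': "a \<in> {1..n+1}" "b \<in> {1..n+1}" using ab assms(4) by auto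
  obtain d where d: "d \<in> {1..n+1}" "d \<noteq> a" "d \<noteq> b" "y = transpose a d \<or> y = transpose b d"
    using assms(3) collinear_transpose[OF ab' ab(4), of y] unfolding ab(1) by blast
  have dj: "d \<in> {1..j+1}"
    using assms(2) d transpose_in_sym_points[of a d j] transpose_in_sym_points[of b d j] by auto
  have "third_point (sym_space n) (transpose a d) (transpose a b) = transpose b d"
    using ab ab' d by (intro third_point_transpose) auto
  moreover have "third_point (sym_space n) (transpose b d) (transpose b a) = transpose a d"
    using ab ab' d by (intro third_point_transpose) auto
  ultimately show ?thesis
    using d ab dj transpose_in_sym_points[of b d j] transpose_in_sym_points[of a d j]
    by (auto simp: transpose_commute[of b a])
qed

lemma card_letters_diff:
  assumes "a \<in> {1..j+1}" "b \<in> {1..j+1}" "a \<noteq> b" "j \<le> n"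
  shows "card (({1..n+1} - {a, b}) \<inter> {d. d \<in> {1..j+1}}) = j - 1"
proof -
  have "({1..n+1} - {a, b}) \<inter> {d. d \<in> {1..j+1}} = {1..j+1} - {a, b}"
    using assms by auto
  also have "card \<dots> = card {1..j+1} - card {a, b}"
    using assms by (intro card_Diff_subset) auto
  finally show ?thesis using assms by simp
qed

text \<open>
  Covers the subspaces \<open>\<A>\<^sub>j\<close> and \<open>\<A>\<^sub>j\<^sup>\<plusminus>\<close> at once, with \<open>S = {1}\<close> and
  \<open>S = {1, -1}\<close>. A point \<open>(a,b)\<^sup>\<epsilon>\<close> has the neighbours \<open>(a,d)\<^sup>\<delta>\<close> and \<open>(b,d)\<^sup>\<delta>\<close>, where \<open>d\<close> is one of
  the \<open>j - 1\<close> other letters and \<open>\<delta> \<in> S\<close>.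
\<close>

lemma regular_subspaceI:
  fixes B :: "((nat \<Rightarrow> nat) \<times> int) set"
  assumes B: "B = points (sym_space j) \<times> S" and S: "S \<subseteq> {1, -1}" "\<forall>s\<in>S. \<forall>t\<in>S. s * t \<in> S"
    and jn: "j \<le> n" and D: "D = 2 * card S * (j - 1)"
  shows "triple_system.regular_subspace (double_sym_space n) B D"
proof -
  interpret S: triple_system "sym_space n" by (rule triple_system_sym_space)
  interpret D: triple_system "double_sym_space n" by (rule triple_system_double_sym_space)
  have "B \<subseteq> points (double_sym_space n)"
    using jn S by (fastforce simp: B double_space_def sym_space_def)
  moreover have "third_point (double_sym_space n) x y \<in> B"
    if "x \<in> B" "y \<in> B" "collinear (double_sym_space n) x y" for x y
  proof -
    obtain x' \<epsilon> y' \<eta> where xy: "x = (x', \<epsilon>)" "y = (y', \<eta>)" by (meson surj_pair)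
    with that(3) have col: "collinear (sym_space n) x' y'"
      by (simp add: S.collinear_double)
    have "third_point (double_sym_space n) x y = (third_point (sym_space n) x' y', \<epsilon> * \<eta>)"
      using that(3) unfolding xy by (rule S.third_point_double)
    then show ?thesis
      using that(1,2) S(2) third_point_closed_sym_points[OF _ _ col jn] by (auto simp: B xy)
  qed
  moreover have "card (D.nbrs z \<inter> B) = D" if zB: "z \<in> B" for z
  proof -
    obtain a b \<epsilon> where z: "z = (transpose a b, \<epsilon>)" "\<epsilon> \<in> {1, -1}"
      and ab: "a \<in> {1..j+1}" "b \<in> {1..j+1}" "a \<noteq> b"
      using zB S(1) by (auto simp: B sym_space_def)
    have abn: "a \<in> {1..n+1}" "b \<in> {1..n+1}" using ab jn by auto
    let ?N = "{1..n+1} - {a, b}" and ?J = "{d. d \<in> {1..j+1}}"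
    have two: "(\<Sum>\<delta>\<in>{1, -1}. of_bool (\<delta> \<in> S) + of_bool (\<delta> \<in> S)) = 2 * card S"
    proof -
      have "(\<Sum>\<delta>\<in>{1, -1}. of_bool (\<delta> \<in> S) + of_bool (\<delta> \<in> S)) = 2 * (\<Sum>\<delta>\<in>{1, -1}. of_bool (\<delta> \<in> S) :: nat)"
        by simp
      also have "(\<Sum>\<delta>\<in>{1, -1}. of_bool (\<delta> \<in> S) :: nat) = card ({1, -1} \<inter> {\<delta>. \<delta> \<in> S})"
        by (subst sum_of_bool_eq) simp_all
      also have "{1, -1} \<inter> {\<delta>. \<delta> \<in> S} = S" using S(1) by auto
      finally show ?thesis .
    qed
    have "card (D.nbrs z \<inter> B) = (\<Sum>y\<in>D.nbrs z. of_bool (y \<in> B))"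
      by (simp add: Int_def)
    also have "\<dots> = (\<Sum>d\<in>?N. \<Sum>\<delta>\<in>{1, -1}. of_bool ((transpose a d, \<delta>) \<in> B) + of_bool ((transpose b d, \<delta>) \<in> B))"
      unfolding z(1) by (rule sum_neighbours_double_sym[OF abn ab(3) z(2)])
    also have "\<dots> = (\<Sum>d\<in>?N. of_bool (d \<in> ?J) * (\<Sum>\<delta>\<in>{1, -1}. of_bool (\<delta> \<in> S) + of_bool (\<delta> \<in> S)))"
    proof (rule sum.cong[OF refl])
      fix d assume "d \<in> ?N"
      then have "(transpose a d, \<delta>) \<in> B \<longleftrightarrow> d \<in> ?J \<and> \<delta> \<in> S" "(transpose b d, \<delta>) \<in> B \<longleftrightarrow> d \<in> ?J \<and> \<delta> \<in> S" for \<delta>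
        using ab transpose_in_sym_points[of a d j] transpose_in_sym_points[of b d j]
        by (auto simp: B)
      then show "(\<Sum>\<delta>\<in>{1, -1}. of_bool ((transpose a d, \<delta>) \<in> B) + of_bool ((transpose b d, \<delta>) \<in> B)) =
          of_bool (d \<in> ?J) * (\<Sum>\<delta>\<in>{1, -1}. of_bool (\<delta> \<in> S) + of_bool (\<delta> \<in> S) :: nat)"
        by (cases "d \<in> ?J") auto
    qed
    also have "\<dots> = card (?N \<inter> ?J) * (2 * card S)"
      unfolding two sum_distrib_right[symmetric] by (subst sum_of_bool_eq) simp_all
    also have "\<dots> = D"
      using card_letters_diff[OF ab jn] D by simp
    finally show ?thesis .
  qed
  ultimately show ?thesis
    by (simp add: D.regular_subspace_def)
qed

lemma card_sym_points: "2 * card (points (sym_space j)) = j * (j + 1)"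
proof (induction j)
  case 0
  have "points (sym_space 0) = {}" by (auto simp: sym_space_def)
  then show ?case by simp
next
  case (Suc j)
  let ?new = "(\<lambda>a. transpose a (j + 2)) ` {1..j+1}"
  have "points (sym_space (Suc j)) = points (sym_space j) \<union> ?new"
  proof (intro set_eqI iffI)
    fix x assume "x \<in> points (sym_space (Suc j))"
    then obtain a b where ab: "x = transpose a b" "a \<in> {1..j+2}" "b \<in> {1..j+2}" "a \<noteq> b"
      by (auto simp: sym_space_def)
    consider "a = j + 2" | "b = j + 2" | "a \<le> j + 1" "b \<le> j + 1" using ab by fastforce
    then show "x \<in> points (sym_space j) \<union> ?new"
    proof cases
      case 1
      then have "x = transpose b (j + 2)" "b \<in> {1..j+1}"
        using ab by (auto simp: transpose_commute)
      then show ?thesis by blast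
    next
      case 2 then show ?thesis using ab by auto
    next
      case 3 then show ?thesis using ab by (auto simp: sym_space_def)
    qed
  next
    fix x assume "x \<in> points (sym_space j) \<union> ?new"
    then show "x \<in> points (sym_space (Suc j))"
    proof
      assume "x \<in> points (sym_space j)" then show ?thesis by (fastforce simp: sym_space_def)
    next
      assume "x \<in> ?new"
      then obtain a where "x = transpose a (j + 2)" "a \<in> {1..j+1}" by blast
      then show ?thesis using transpose_in_sym_points[of a "j + 2" "Suc j"] by auto
    qed
  qed
  moreover have "points (sym_space j) \<inter> ?new = {}"
  proof -
    have "transpose a (j + 2) \<notin> points (sym_space j)" if "a \<in> {1..j+1}" for a
      using that transpose_in_sym_points[of a "j + 2" j] by auto
    then show ?thesis by blast
  qed
  moreover have "card ?new = j + 1"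
    by (subst card_image) (auto simp: inj_on_def transpose_eq_iff)
  ultimately have "card (points (sym_space (Suc j))) = card (points (sym_space j)) + (j + 1)"
    by (simp add: card_Un_disjoint finite_sym_points)
  with Suc.IH show ?case by (simp add: algebra_simps)
qed

section \<open>Products in coordinates\<close>

text \<open>
  For the constant weight \<open>1\<close> this is the graph Laplacian of the line graph of the complete graph
  on \<open>{1..n+1}\<close>, whose vertices are the edges \<open>{a, b}\<close>.
\<close>

definition laplacian :: "nat \<Rightarrow> (nat \<Rightarrow> nat \<Rightarrow> 'f) \<Rightarrow> (nat \<Rightarrow> nat \<Rightarrow> 'f) \<Rightarrow> nat \<Rightarrow> nat \<Rightarrow> 'f::comm_ring_1" where
  "laplacian n w f a b = (\<Sum>d\<in>{1..n+1} - {a, b}. w a d * (f a b - f b d) + w b d * (f a b - f a d))"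

text \<open>
  A factor \<open>x\<^sup>+\<close> preserves the sign of \<open>y\<^sup>\<delta>\<close> in the terms \<open>y\<^sup>\<delta>\<close> and \<open>(x \<and> y)\<^sup>\<delta>\<close> of the product,
  and these terms form the Laplacian. The remaining term \<open>x\<^sup>+\<close> has sign \<open>+\<close> whatever \<open>\<delta>\<close> is:
  this is the only way in which the coefficients at \<open>y\<^sup>-\<close> influence those at \<open>x\<^sup>+\<close>.
\<close>

lemma lookup_mult_plus_supported:
  fixes \<alpha> :: "'f::field_char_0"
  assumes u: "u \<in> free_space (points (double_sym_space n))"
    and v: "v \<in> free_space (points (double_sym_space n))"
    and ab: "a \<in> {1..n+1}" "b \<in> {1..n+1}" "a \<noteq> b"
    and pos: "\<And>x. Poly_Mapping.lookup u (x, -1) = 0"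
  defines "w \<equiv> \<lambda>a b. Poly_Mapping.lookup u (transpose a b, 1)"
    and "V \<equiv> \<lambda>\<epsilon> a b. Poly_Mapping.lookup v (transpose a b, \<epsilon>)"
  shows "Poly_Mapping.lookup (matsuo_mult \<alpha> (double_sym_space n) u v) (transpose a b, -1) =
      \<alpha> / 2 * laplacian n w (V (-1)) a b"
    and "Poly_Mapping.lookup (matsuo_mult \<alpha> (double_sym_space n) u v) (transpose a b, 1) =
      \<alpha> / 2 * laplacian n w (V 1) a b + w a b * (V 1 a b
        + \<alpha> / 2 * (\<Sum>d\<in>{1..n+1} - {a, b}. V 1 a d + V 1 b d + V (-1) a d + V (-1) b d))"
proof -
  interpret S: triple_system "sym_space n" by (rule triple_system_sym_space)
  interpret D: triple_system "double_sym_space n" by (rule triple_system_double_sym_space)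
  let ?N = "{1..n+1} - {a, b}" and ?G = "double_sym_space n"
  have third: "third_point ?G (transpose a d, \<delta>) (transpose a b, \<epsilon>) = (transpose b d, \<delta> * \<epsilon>)"
      "third_point ?G (transpose b d, \<delta>) (transpose a b, \<epsilon>) = (transpose a d, \<delta> * \<epsilon>)"
    if "d \<in> ?N" "\<delta> \<in> {1, -1}" "\<epsilon> \<in> {1, -1}" for d \<delta> \<epsilon>
  proof -
    have "collinear (sym_space n) (transpose a d) (transpose a b)"
         "collinear (sym_space n) (transpose b d) (transpose a b)"
      using that collinear_transpose[OF ab] by blast+
    then have "collinear ?G (transpose a d, \<delta>) (transpose a b, \<epsilon>)"
        "collinear ?G (transpose b d, \<delta>) (transpose a b, \<epsilon>)"
      using that by (simp_all add: S.collinear_double)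
    note S.third_point_double[OF this(1)] S.third_point_double[OF this(2)]
    moreover have "third_point (sym_space n) (transpose a d) (transpose a b) = transpose b d"
      using that ab by (intro third_point_transpose) auto
    moreover have "third_point (sym_space n) (transpose b d) (transpose b a) = transpose a d"
      using that ab by (intro third_point_transpose) auto
    ultimately show "third_point ?G (transpose a d, \<delta>) (transpose a b, \<epsilon>) = (transpose b d, \<delta> * \<epsilon>)"
      "third_point ?G (transpose b d, \<delta>) (transpose a b, \<epsilon>) = (transpose a d, \<delta> * \<epsilon>)"
      by (simp_all add: transpose_commute[of b a])
  qed
  define U where "U = (\<lambda>\<epsilon> a b. Poly_Mapping.lookup u (transpose a b, \<epsilon>))"
  have U: "U 1 = w" "U (-1) = (\<lambda>_ _. 0)"
    using pos by (simp_all add: U_def w_def)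
  have eq: "Poly_Mapping.lookup (matsuo_mult \<alpha> ?G u v) (transpose a b, \<epsilon>) =
      U \<epsilon> a b * V \<epsilon> a b + \<alpha> / 2 * (\<Sum>d\<in>?N. \<Sum>\<delta>\<in>{1, -1}.
          (U \<epsilon> a b * V \<delta> a d + U \<delta> a d * V \<epsilon> a b - U \<delta> a d * V (\<delta> * \<epsilon>) b d)
        + (U \<epsilon> a b * V \<delta> b d + U \<delta> b d * V \<epsilon> a b - U \<delta> b d * V (\<delta> * \<epsilon>) a d))"
    if e: "\<epsilon> \<in> {1, -1}" for \<epsilon>
  proof -
    have "(transpose a b, \<epsilon>) \<in> points ?G"
      using ab(1,2) e in_double_sym_points[OF ab(3)] by blast
    note product = D.lookup_matsuo_mult[OF u v this, of \<alpha>, unfolded sum_neighbours_double_sym[OF ab e]]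
    show ?thesis
      unfolding product U_def V_def
      by (intro arg_cong2[where f = "(+)"] arg_cong2[where f = "(*)"] sum.cong refl)
         (simp_all only: third[OF _ _ e])
  qed
  show "Poly_Mapping.lookup (matsuo_mult \<alpha> ?G u v) (transpose a b, -1) =
      \<alpha> / 2 * laplacian n w (V (-1)) a b"
    by (simp add: eq U laplacian_def algebra_simps)
  show "Poly_Mapping.lookup (matsuo_mult \<alpha> ?G u v) (transpose a b, 1) =
      \<alpha> / 2 * laplacian n w (V 1) a b + w a b * (V 1 a b
        + \<alpha> / 2 * (\<Sum>d\<in>?N. V 1 a d + V 1 b d + V (-1) a d + V (-1) b d))"
    by (simp add: eq U laplacian_def algebra_simps sum.distrib sum_subtractf sum_distrib_left)
qed

section \<open>Eigenfunctions of the weighted Laplacian\<close>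

text \<open>
  The diagonal is set to zero because \<open>transpose a a\<close> is the identity, which is not a point.
  Row sums may then run over all letters.
\<close>

definition edge_function :: "(nat \<Rightarrow> nat \<Rightarrow> 'f::zero) \<Rightarrow> bool" where
  "edge_function f \<longleftrightarrow> (\<forall>a b. f a b = f b a) \<and> (\<forall>a. f a a = 0)"

text \<open>
  The coefficients of \<open>id\<^sub>i - id\<^bsub>i-1\<^esub>\<close>, when \<open>k\<close> and \<open>l\<close> are the coefficients of the two identities.
\<close>

definition layer_weight :: "nat \<Rightarrow> 'f \<Rightarrow> 'f \<Rightarrow> nat \<Rightarrow> nat \<Rightarrow> 'f::comm_ring_1" where
  "layer_weight i k l a b =
    (if a \<noteq> b \<and> a \<in> {1..i+1} \<and> b \<in> {1..i+1}
     then if a = i + 1 \<or> b = i + 1 then k else k - l else 0)"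

lemma layer_weight_simps:
  "a \<in> {1..i} \<Longrightarrow> b \<in> {1..i} \<Longrightarrow> a \<noteq> b \<Longrightarrow> layer_weight i k l a b = k - l"
  "a \<in> {1..i} \<Longrightarrow> layer_weight i k l a (Suc i) = k"
  "a \<in> {1..i} \<Longrightarrow> layer_weight i k l (Suc i) a = k"
  "Suc i < a \<Longrightarrow> layer_weight i k l a b = 0"
  "Suc i < b \<Longrightarrow> layer_weight i k l a b = 0"
  by (auto simp: layer_weight_def)

lemma sum_remove2:
  fixes X :: "nat \<Rightarrow> 'a::ab_group_add"
  assumes "finite L" "a \<in> L" "b \<in> L" "a \<noteq> b"
  shows "sum X (L - {a, b}) = sum X L - X a - X b"
proof -
  have "sum X (L - {a, b}) = sum X L - sum X {a, b}"
    using assms by (intro sum_diff) auto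
  then show ?thesis using assms by simp
qed

lemma sum_remove1:
  fixes X :: "nat \<Rightarrow> 'a::ab_group_add"
  assumes "finite L" "a \<in> L"
  shows "sum X (L - {a}) = sum X L - X a"
  using assms by (simp add: sum_diff1)

definition row_sum :: "nat \<Rightarrow> (nat \<Rightarrow> nat \<Rightarrow> 'f) \<Rightarrow> nat \<Rightarrow> 'f::comm_monoid_add" where
  "row_sum i f a = (\<Sum>d\<in>{1..i}. f a d)"

context
  fixes i n :: nat and k l :: "'f::comm_ring_1" and f :: "nat \<Rightarrow> nat \<Rightarrow> 'f"
  assumes i_less: "i < n" and f: "edge_function f"
begin

abbreviation (input) "lap \<equiv> laplacian n (layer_weight i k l) f"

lemma f_sym: "f a b = f b a" and f_diag: "f a a = 0"
  using f unfolding edge_function_def by blast+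

text \<open>
  The next lemmas evaluate the Laplacian on the five kinds of edges that arise from the classes of
  inner letters \<open>1..i\<close>, the top letter \<open>i+1\<close> and outer letters. The weight is constant on each
  kind, so that the sum over \<open>d\<close> becomes a row sum.
\<close>

lemma laplacian_outer_outer:
  assumes "Suc i < a" "Suc i < b"
  shows "lap a b = 0"
  using assms by (simp add: laplacian_def layer_weight_simps)

lemma laplacian_inner_outer:
  assumes a: "a \<in> {1..i}" and b: "Suc i < b"
  shows "lap a b =
    (k - l) * (of_nat i * f a b - row_sum i f b) + k * (f a b - f (Suc i) b)"
proof -
  have "lap a b = (\<Sum>d\<in>{1..n+1} - {a, b}. layer_weight i k l a d * (f a b - f b d))"
    using b by (simp add: laplacian_def layer_weight_simps)
  also have "\<dots> = (\<Sum>d\<in>insert (Suc i) ({1..i} - {a}). layer_weight i k l a d * (f a b - f b d))"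
    using i_less a b by (intro sum.mono_neutral_right ballI) (auto simp: layer_weight_simps)
  also have "\<dots> = k * (f a b - f (Suc i) b) + (\<Sum>d\<in>{1..i} - {a}. (k - l) * (f a b - f b d))"
    using a by (subst sum.insert) (auto simp: layer_weight_simps f_sym[of b "Suc i"] intro!: sum.cong)
  also have "(\<Sum>d\<in>{1..i} - {a}. (k - l) * (f a b - f b d)) =
      (\<Sum>d\<in>{1..i}. (k - l) * (f a b - f b d)) - (k - l) * (f a b - f b a)"
    using a by (intro sum_remove1) auto
  also have "\<dots> = (k - l) * (of_nat i * f a b - row_sum i f b)"
    by (simp add: row_sum_def f_sym[of b a] sum_distrib_left[symmetric] sum_subtractf)
  finally show ?thesis by (simp add: add.commute)
qed

lemma laplacian_top_outer:
  assumes b: "Suc i < b"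
  shows "lap (Suc i) b = k * (of_nat i * f (Suc i) b - row_sum i f b)"
proof -
  have "lap (Suc i) b =
      (\<Sum>d\<in>{1..n+1} - {Suc i, b}. layer_weight i k l (Suc i) d * (f (Suc i) b - f b d))"
    using b by (simp add: laplacian_def layer_weight_simps)
  also have "\<dots> = (\<Sum>d\<in>{1..i}. layer_weight i k l (Suc i) d * (f (Suc i) b - f b d))"
    using i_less b by (intro sum.mono_neutral_right ballI) (auto simp: layer_weight_simps)
  also have "\<dots> = (\<Sum>d\<in>{1..i}. k * (f (Suc i) b - f b d))"
    by (intro sum.cong refl) (simp add: layer_weight_simps)
  finally show ?thesis
    by (simp add: row_sum_def sum_distrib_left[symmetric] sum_subtractf)
qed

lemma laplacian_inner_top:
  assumes a: "a \<in> {1..i}"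
  shows "lap a (Suc i) = (k - l) * (of_nat i * f a (Suc i) - row_sum i f (Suc i))
    + k * ((of_nat i - 1) * f a (Suc i) - row_sum i f a)"
proof -
  let ?X = "\<lambda>d. (k - l) * (f a (Suc i) - f (Suc i) d) + k * (f a (Suc i) - f a d)"
  have "lap a (Suc i) = (\<Sum>d\<in>{1..i} - {a}. layer_weight i k l a d * (f a (Suc i) - f (Suc i) d)
      + layer_weight i k l (Suc i) d * (f a (Suc i) - f a d))"
    using i_less a unfolding laplacian_def
    by (intro sum.mono_neutral_right ballI) (auto simp: layer_weight_simps)
  also have "\<dots> = (\<Sum>d\<in>{1..i} - {a}. ?X d)"
    using a by (intro sum.cong refl) (simp add: layer_weight_simps)
  also have "\<dots> = (\<Sum>d\<in>{1..i}. ?X d) - ?X a"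
    using a by (intro sum_remove1) auto
  also have "(\<Sum>d\<in>{1..i}. ?X d) = (k - l) * (of_nat i * f a (Suc i) - row_sum i f (Suc i))
      + k * (of_nat i * f a (Suc i) - row_sum i f a)"
    by (simp add: row_sum_def sum.distrib sum_distrib_left[symmetric] sum_subtractf)
  finally show ?thesis
    by (simp add: f_diag f_sym[of "Suc i" a] algebra_simps)
qed

lemma laplacian_inner_inner:
  assumes a: "a \<in> {1..i}" and b: "b \<in> {1..i}" and ab: "a \<noteq> b"
  shows "lap a b = (k - l) * ((2 * of_nat i - 2) * f a b - row_sum i f a - row_sum i f b)
    + k * (2 * f a b - f a (Suc i) - f b (Suc i))"
proof -
  let ?X = "\<lambda>d. (k - l) * (2 * f a b - f b d - f a d)"
  let ?Y = "\<lambda>d. layer_weight i k l a d * (f a b - f b d) + layer_weight i k l b d * (f a b - f a d)"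
  have "lap a b = (\<Sum>d\<in>insert (Suc i) ({1..i} - {a, b}). ?Y d)"
    using i_less a b unfolding laplacian_def
    by (intro sum.mono_neutral_right ballI) (auto simp: layer_weight_simps)
  also have "\<dots> = ?Y (Suc i) + (\<Sum>d\<in>{1..i} - {a, b}. ?Y d)"
    by (rule sum.insert) auto
  also have "(\<Sum>d\<in>{1..i} - {a, b}. ?Y d) = (\<Sum>d\<in>{1..i} - {a, b}. ?X d)"
    using a b by (intro sum.cong refl) (simp add: layer_weight_simps algebra_simps)
  also have "\<dots> = (\<Sum>d\<in>{1..i}. ?X d) - ?X a - ?X b"
    using a b ab by (intro sum_remove2) auto
  also have "(\<Sum>d\<in>{1..i}. ?X d) = (k - l) * (of_nat i * (2 * f a b) - row_sum i f b - row_sum i f a)"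
    by (simp add: row_sum_def sum_distrib_left[symmetric] sum_subtractf)
  finally show ?thesis
    using a b by (simp add: layer_weight_simps f_diag f_sym[of b a] algebra_simps)
qed

lemma sum_remove_pair:
  assumes "a \<in> {1..n+1}" "b \<in> {1..n+1}" "a \<noteq> b"
  shows "(\<Sum>d\<in>{1..n+1} - {a, b}. f a d + f b d) =
    row_sum (n+1) f a + row_sum (n+1) f b - 2 * f a b"
  using sum_remove2[of "{1..n+1}" a b "\<lambda>d. f a d + f b d"] assms
  by (simp add: row_sum_def sum.distrib f_diag f_sym[of b a] algebra_simps del: sum.cl_ivl_Suc)

lemma row_inner:
  assumes "\<And>d. Suc i < d \<Longrightarrow> f a d = 0"
  shows "row_sum (n+1) f a = row_sum i f a + f a (Suc i)"
proof -
  have "row_sum (n+1) f a = (\<Sum>d\<in>insert (Suc i) {1..i}. f a d)"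
    unfolding row_sum_def using i_less assms by (intro sum.mono_neutral_right ballI) auto
  then show ?thesis by (simp add: row_sum_def add.commute)
qed

end

lemma laplacian_cong:
  assumes "\<And>a b. a \<in> {1..n+1} \<Longrightarrow> b \<in> {1..n+1} \<Longrightarrow> a \<noteq> b \<Longrightarrow> f a b = f' a b"
    and "\<And>a b. a \<in> {1..n+1} \<Longrightarrow> b \<in> {1..n+1} \<Longrightarrow> a \<noteq> b \<Longrightarrow> w a b = w' a b"
    and "a \<in> {1..n+1}" "b \<in> {1..n+1}" "a \<noteq> b"
  shows "laplacian n w f a b = laplacian n w' f' a b"
  unfolding laplacian_def by (intro sum.cong refl) (use assms in auto)

lemma laplacian_scale: "laplacian n w (\<lambda>a b. c * f a b) a b = c * laplacian n w f a b"
  by (simp add: laplacian_def sum_distrib_left algebra_simps)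

lemma scaled_eq_cancel:
  fixes \<mu> \<nu> x :: "'f::idom"
  assumes "\<mu> * x = \<nu> * x" "\<mu> \<noteq> \<nu>"
  shows "x = 0"
  using assms by simp

context
  fixes i n :: nat and k l \<beta> \<mu> :: "'f::field_char_0" and f :: "nat \<Rightarrow> nat \<Rightarrow> 'f"
  assumes i_less: "i < n" and i2: "2 \<le> i" and f: "edge_function f"
    and \<mu>0: "\<mu> \<noteq> 0"
begin

text \<open>
  For a fixed outer letter \<open>b\<close>, the function \<open>a \<mapsto> f a b\<close> satisfies a closed system. Its total is
  killed by \<open>\<mu> \<noteq> 0\<close>, its value at the top letter by \<open>\<mu>1\<close>, and its values at inner letters by \<open>\<mu>2\<close>.
\<close>

lemma outer_eigenfunction_zero:
  assumes eig: "\<And>a b. a \<in> {1..n+1} \<Longrightarrow> b \<in> {1..n+1} \<Longrightarrow> a \<noteq> b \<Longrightarrow> Suc i < b \<Longrightarrow>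
      \<mu> * f a b = \<beta> * laplacian n (layer_weight i k l) f a b"
    and \<mu>1: "\<mu> \<noteq> \<beta> * (k * (of_nat i + 1))"
    and \<mu>2: "\<mu> \<noteq> \<beta> * (k * (of_nat i + 1) - l * of_nat i)"
    and a: "a \<in> {1..n+1}" and b: "b \<in> {1..n+1}" and out: "Suc i < b"
  shows "f a b = 0"
proof -
  note f_sym = f_sym[OF i_less f] and f_diag = f_diag[OF i_less f]
  let ?F = "row_sum i f b" and ?T = "f (Suc i) b"
  have top: "\<mu> * ?T = \<beta> * (k * (of_nat i * ?T - ?F))"
    using eig[of "Suc i" b] laplacian_top_outer[OF i_less f out, of k l] b out by auto
  have inner: "\<mu> * f d b = \<beta> * ((k - l) * (of_nat i * f d b - ?F) + k * (f d b - ?T))"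
    if "d \<in> {1..i}" for d
    using eig[of d b] laplacian_inner_outer[OF i_less f that out, of k l] b out that i_less by auto
  have F: "?F = (\<Sum>d\<in>{1..i}. f d b)"
    unfolding row_sum_def by (intro sum.cong refl f_sym)
  have "\<mu> * ?F = (\<Sum>d\<in>{1..i}. \<beta> * ((k - l) * (of_nat i * f d b - ?F) + k * (f d b - ?T)))"
    unfolding F sum_distrib_left using inner F by (intro sum.cong refl) simp
  also have "\<dots> = \<beta> * (k * (?F - of_nat i * ?T))"
    by (simp add: F sum_distrib_left[symmetric] sum.distrib sum_subtractf algebra_simps)
  finally have sum: "\<mu> * ?F = \<beta> * (k * (?F - of_nat i * ?T))" .
  have "\<mu> * (?F + ?T) = 0"
    unfolding distrib_left[of \<mu>] top sum by (simp add: algebra_simps)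
  then have FT: "?F = - ?T" using \<mu>0 by (simp add: eq_neg_iff_add_eq_0)
  have "\<mu> * ?T = \<beta> * (k * (of_nat i + 1)) * ?T"
    using top unfolding FT by (simp add: algebra_simps)
  then have T: "?T = 0" using \<mu>1 by (rule scaled_eq_cancel)
  have inner0: "f d b = 0" if "d \<in> {1..i}" for d
  proof -
    have "\<mu> * f d b = \<beta> * (k * (of_nat i + 1) - l * of_nat i) * f d b"
      using inner[OF that] unfolding FT T by (simp add: algebra_simps)
    then show ?thesis using \<mu>2 by (rule scaled_eq_cancel)
  qed
  consider "a \<in> {1..i}" | "a = Suc i" | "a = b" | "Suc i < a" "a \<noteq> b" using a by force
  then show ?thesis
  proof cases
    case 4
    then have "\<mu> * f a b = 0"
      using eig[of a b] laplacian_outer_outer[OF i_less f, of a b k l] a b out by simp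
    then show ?thesis using \<mu>0 by simp
  qed (use inner0 T f_diag in auto)
qed

text \<open>
  Let \<open>g a = f a (i+1)\<close> and let \<open>H a\<close> be the row sum over the inner letters. The totals of \<open>g\<close>
  and \<open>H\<close> satisfy a two-by-two system with eigenvalues \<open>0\<close> and that in \<open>\<mu>1\<close>. Once they vanish,
  so do \<open>g a + H a\<close> and \<open>(i - 2) g a - H a\<close>, the eigencombinations of the system for \<open>(g a, H a)\<close>,
  by \<open>\<mu>2\<close> and \<open>\<mu>3\<close>. Finally \<open>f\<close> has vanishing row sums, where the operator is the scalar in \<open>\<mu>4\<close>.
\<close>

lemma inner_eigenfunction_zero:
  assumes eig: "\<And>a b. a \<in> {1..i+1} \<Longrightarrow> b \<in> {1..i+1} \<Longrightarrow> a \<noteq> b \<Longrightarrow>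
      \<mu> * f a b = \<beta> * laplacian n (layer_weight i k l) f a b"
    and \<mu>1: "\<mu> \<noteq> \<beta> * (k * (of_nat i + 1))"
    and \<mu>2: "\<mu> \<noteq> \<beta> * (k * (of_nat i + 1) - l * of_nat i)"
    and \<mu>3: "\<mu> \<noteq> \<beta> * (2 * k * of_nat i - l * of_nat i)"
    and \<mu>4: "\<mu> \<noteq> \<beta> * (2 * k * of_nat i - 2 * l * (of_nat i - 1))"
    and a: "a \<in> {1..i+1}" and b: "b \<in> {1..i+1}"
  shows "f a b = 0"
proof -
  note f_sym = f_sym[OF i_less f] and f_diag = f_diag[OF i_less f]
  let ?t = "Suc i"
  let ?G = "row_sum i f ?t" and ?g = "\<lambda>a. f a ?t" and ?H = "row_sum i f"
  define HH where "HH = (\<Sum>d\<in>{1..i}. ?H d)"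
  have G: "?G = (\<Sum>d\<in>{1..i}. ?g d)"
    unfolding row_sum_def by (intro sum.cong refl f_sym)
  have top: "\<mu> * ?g a = \<beta> * ((k - l) * (of_nat i * ?g a - ?G) + k * ((of_nat i - 1) * ?g a - ?H a))"
    if "a \<in> {1..i}" for a
    using eig[of a ?t] laplacian_inner_top[OF i_less f that, of k l] that by auto
  let ?X = "\<lambda>a b. (k - l) * ((2 * of_nat i - 2) * f a b - ?H a - ?H b) + k * (2 * f a b - ?g a - ?g b)"
  have inner: "\<mu> * f a b = \<beta> * ?X a b" if "a \<in> {1..i}" "b \<in> {1..i}" "a \<noteq> b" for a b
    using eig[of a b] laplacian_inner_inner[OF i_less f that, of k l] that by auto
  have row: "\<mu> * ?H a = \<beta> * ((k - l) * (of_nat i * ?H a - HH) + k * (2 * ?H a - (of_nat i - 2) * ?g a - ?G))"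
    if a: "a \<in> {1..i}" for a
  proof -
    have "\<mu> * ?H a = (\<Sum>b\<in>{1..i} - {a}. \<mu> * f a b)"
      using a by (simp add: row_sum_def sum_distrib_left sum_remove1 f_diag)
    also have "\<dots> = (\<Sum>b\<in>{1..i} - {a}. \<beta> * ?X a b)"
      using inner a by (intro sum.cong refl) auto
    also have "\<dots> = (\<Sum>b\<in>{1..i}. \<beta> * ?X a b) - \<beta> * ?X a a"
      using a by (intro sum_remove1) auto
    also have "(\<Sum>b\<in>{1..i}. \<beta> * ?X a b) = \<beta> * ((k - l) * ((2 * of_nat i - 2) * ?H a - of_nat i * ?H a - HH)
        + k * (2 * ?H a - of_nat i * ?g a - ?G))"
      by (simp add: HH_def G sum_distrib_left[symmetric] sum.distrib sum_subtractf)
        (simp add: row_sum_def)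
    finally show ?thesis by (simp add: f_diag algebra_simps)
  qed
  have sum_top: "\<mu> * ?G = \<beta> * (k * ((of_nat i - 1) * ?G - HH))"
  proof -
    have "\<mu> * ?G = (\<Sum>a\<in>{1..i}. \<mu> * ?g a)"
      by (simp add: G sum_distrib_left)
    also have "\<dots> = (\<Sum>a\<in>{1..i}. \<beta> * ((k - l) * (of_nat i * ?g a - ?G) + k * ((of_nat i - 1) * ?g a - ?H a)))"
      using top by (intro sum.cong refl) auto
    finally show ?thesis
      by (simp add: HH_def G sum_distrib_left[symmetric] sum.distrib sum_subtractf)
  qed
  have sum_row: "\<mu> * HH = \<beta> * (k * (2 * HH - (2 * of_nat i - 2) * ?G))"
  proof -
    have "\<mu> * HH = (\<Sum>a\<in>{1..i}. \<mu> * ?H a)"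
      by (simp add: HH_def sum_distrib_left)
    also have "\<dots> = (\<Sum>a\<in>{1..i}. \<beta> * ((k - l) * (of_nat i * ?H a - HH) + k * (2 * ?H a - (of_nat i - 2) * ?g a - ?G)))"
      using row by (intro sum.cong refl) auto
    also have "\<dots> = \<beta> * ((k - l) * (of_nat i * HH - of_nat i * HH)
        + k * (2 * HH - (of_nat i - 2) * ?G - of_nat i * ?G))"
      by (simp add: HH_def G sum_distrib_left[symmetric] sum.distrib sum_subtractf)
    finally show ?thesis by (simp add: algebra_simps)
  qed
  have "\<mu> * (HH + 2 * ?G) = \<mu> * HH + 2 * (\<mu> * ?G)"
    by (simp add: algebra_simps)
  also have "\<dots> = 0"
    unfolding sum_top sum_row by (simp add: algebra_simps)
  finally have "\<mu> * (HH + 2 * ?G) = 0" .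
  then have HH: "HH = - 2 * ?G" using \<mu>0 by (simp add: eq_neg_iff_add_eq_0)
  have "\<mu> * ?G = \<beta> * (k * (of_nat i + 1)) * ?G"
    using sum_top unfolding HH by (simp add: algebra_simps)
  then have G0: "?G = 0" using \<mu>1 by (rule scaled_eq_cancel)
  then have HH0: "HH = 0" using HH by simp
  have gH: "?g a = 0 \<and> ?H a = 0" if a: "a \<in> {1..i}" for a
  proof -
    have "\<mu> * (?g a + ?H a) = \<beta> * (k * (of_nat i + 1) - l * of_nat i) * (?g a + ?H a)"
      unfolding distrib_left[of \<mu>] top[OF a] row[OF a] G0 HH0 by (simp add: algebra_simps)
    then have 1: "?g a + ?H a = 0" using \<mu>2 by (rule scaled_eq_cancel)
    have "\<mu> * ((of_nat i - 2) * ?g a - ?H a) = (of_nat i - 2) * (\<mu> * ?g a) - \<mu> * ?H a"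
      by (simp add: algebra_simps)
    also have "\<dots> = \<beta> * (2 * k * of_nat i - l * of_nat i) * ((of_nat i - 2) * ?g a - ?H a)"
      unfolding top[OF a] row[OF a] G0 HH0 by (simp add: algebra_simps)
    finally have 2: "(of_nat i - 2) * ?g a - ?H a = 0" using \<mu>3 by (rule scaled_eq_cancel)
    have "(of_nat i - 1) * ?g a = 0"
      using 1 2 by (simp add: algebra_simps add_eq_0_iff)
    moreover have "(of_nat i :: 'f) \<noteq> 1"
      using i2 by simp
    ultimately have "?g a = 0" by simp
    with 1 show ?thesis by simp
  qed
  have inner0: "f a b = 0" if "a \<in> {1..i}" "b \<in> {1..i}" "a \<noteq> b" for a b
  proof -
    have "\<mu> * f a b = \<beta> * (2 * k * of_nat i - 2 * l * (of_nat i - 1)) * f a b"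
      using inner[OF that] gH[OF that(1)] gH[OF that(2)] by (simp add: algebra_simps)
    then show ?thesis using \<mu>4 by (rule scaled_eq_cancel)
  qed
  have "a \<in> {1..i} \<or> a = ?t" "b \<in> {1..i} \<or> b = ?t" using a b by auto
  then show ?thesis
    using inner0[of a b] gH[of a] gH[of b] f_sym[of ?t b] f_diag by (cases "a = b") auto
qed

text \<open>
  Here \<open>f\<close> describes a vector of the subalgebra of \<open>\<A>\<^sub>i\<close>, on which \<open>id\<^sub>i\<close> acts as the identity: this is
  the content of the equations for \<open>k\<close> and \<open>l\<close>. So the operator is \<open>1 - id\<^bsub>i-1\<^esub>\<close>. On the
  coefficients at edges to the top letter it has the eigenvalues \<open>1\<close> (on their sum) and \<open>1 - \<beta> l i\<close>,
  and, once these coefficients vanish, the eigenvalue \<open>0\<close> on inner edges.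
\<close>

lemma subalgebra_eigenvector_zero:
  assumes k: "k * (1 + 2 * \<beta> * (of_nat i - 1)) = 1" and l: "l * (1 + 2 * \<beta> * (of_nat i - 2)) = 1"
    and out: "\<And>a b. Suc i < b \<Longrightarrow> f a b = 0"
    and eig: "\<And>a b. a \<in> {1..i+1} \<Longrightarrow> b \<in> {1..i+1} \<Longrightarrow> a \<noteq> b \<Longrightarrow>
      \<mu> * f a b = \<beta> * laplacian n (layer_weight i k l) f a b + layer_weight i k l a b *
        (f a b + \<beta> * (row_sum (n+1) f a + row_sum (n+1) f b - 2 * f a b))"
    and \<mu>1: "\<mu> \<noteq> 1" and \<mu>2: "\<mu> \<noteq> 1 - \<beta> * l * of_nat i"
    and a: "a \<in> {1..i+1}" and b: "b \<in> {1..i+1}"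
  shows "f a b = 0"
proof -
  note f_sym = f_sym[OF i_less f] and f_diag = f_diag[OF i_less f]
  let ?t = "Suc i"
  let ?G = "row_sum i f ?t" and ?g = "\<lambda>a. f a ?t" and ?H = "row_sum i f"
  have row: "row_sum (n+1) f a = ?H a + ?g a" for a
    using row_inner[OF i_less f] out by blast
  have G: "?G = (\<Sum>d\<in>{1..i}. ?g d)"
    unfolding row_sum_def by (intro sum.cong refl f_sym)
  have top: "\<mu> * ?g a = (1 - \<beta> * l * of_nat i) * ?g a + \<beta> * l * ?G" if a: "a \<in> {1..i}" for a
  proof -
    have "\<mu> * ?g a = \<beta> * ((k - l) * (of_nat i * ?g a - ?G) + k * ((of_nat i - 1) * ?g a - ?H a))
        + k * (?g a + \<beta> * ((?H a + ?g a) + (?G + 0) - 2 * ?g a))"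
      using eig[of a ?t] laplacian_inner_top[OF i_less f a, of k l] a row[of a] row[of ?t]
      by (simp add: layer_weight_simps f_diag)
    also have "\<dots> = k * (1 + 2 * \<beta> * (of_nat i - 1)) * ?g a - \<beta> * l * of_nat i * ?g a + \<beta> * l * ?G"
      by (simp add: algebra_simps)
    finally show ?thesis unfolding k by (simp add: algebra_simps)
  qed
  have "\<mu> * ?G = (\<Sum>a\<in>{1..i}. \<mu> * ?g a)"
    by (simp add: G sum_distrib_left)
  also have "\<dots> = (\<Sum>a\<in>{1..i}. (1 - \<beta> * l * of_nat i) * ?g a + \<beta> * l * ?G)"
    using top by (intro sum.cong refl) auto
  also have "\<dots> = (1 - \<beta> * l * of_nat i) * ?G + of_nat i * (\<beta> * l * ?G)"
    unfolding sum.distrib sum_distrib_left[symmetric] G[symmetric] by simp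
  also have "\<dots> = 1 * ?G"
    by (simp add: algebra_simps)
  finally have G0: "?G = 0" using \<mu>1 by (rule scaled_eq_cancel)
  have g0: "?g a = 0" if "a \<in> {1..i}" for a
    using top[OF that] \<mu>2 unfolding G0 by (intro scaled_eq_cancel[of \<mu> _ "1 - \<beta> * l * of_nat i"]) simp_all
  have inner0: "f a b = 0" if "a \<in> {1..i}" "b \<in> {1..i}" "a \<noteq> b" for a b
  proof -
    have "\<mu> * f a b = \<beta> * ((k - l) * ((2 * of_nat i - 2) * f a b - ?H a - ?H b) + k * (2 * f a b))
        + (k - l) * (f a b + \<beta> * (?H a + ?H b - 2 * f a b))"
      using eig[of a b] laplacian_inner_inner[OF i_less f that, of k l] that g0[OF that(1)] g0[OF that(2)]
        row[of a] row[of b]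
      by (simp add: layer_weight_simps)
    also have "\<dots> = (k * (1 + 2 * \<beta> * (of_nat i - 1)) - l * (1 + 2 * \<beta> * (of_nat i - 2))) * f a b"
      by (simp add: algebra_simps)
    finally show ?thesis unfolding k l using \<mu>0 by simp
  qed
  have "a \<in> {1..i} \<or> a = ?t" "b \<in> {1..i} \<or> b = ?t" using a b by auto
  then show ?thesis
    using inner0[of a b] g0[of a] g0[of b] f_sym[of ?t b] f_diag by (cases "a = b") auto
qed

end

section \<open>Eigenvectors in coordinates\<close>

lemma edge_function_lookup:
  assumes "v \<in> free_space (points (double_sym_space n))"
  shows "edge_function (\<lambda>a b. Poly_Mapping.lookup v (transpose a b, \<epsilon>))"
proof -
  have "(id, \<epsilon>) \<notin> points (double_sym_space n)"
  proof
    assume "(id, \<epsilon>) \<in> points (double_sym_space n)"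
    then obtain a b :: nat where "a \<noteq> b" "transpose a b = id"
      by (auto simp: double_space_def sym_space_def)
    then show False using transpose_eq_iff[of a b a a] by simp
  qed
  then show ?thesis
    using assms by (simp add: edge_function_def free_space_lookup transpose_commute)
qed

text \<open>
  \<open>SOME\<close> picks one of the two letters that a transposition moves; for symmetric \<open>F \<epsilon>\<close> the choice does
  not matter.
\<close>

definition edge_vector ::
    "nat \<Rightarrow> (int \<Rightarrow> nat \<Rightarrow> nat \<Rightarrow> 'f::comm_monoid_add) \<Rightarrow> ((nat \<Rightarrow> nat) \<times> int \<Rightarrow>\<^sub>0 'f)" where
  "edge_vector n F =
    point_vector (points (double_sym_space n)) (\<lambda>(x, \<epsilon>). let a = SOME a. x a \<noteq> a in F \<epsilon> a (x a))"

lemma finite_double_sym_points: "finite (points (double_sym_space n))"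
  using triple_system_double_sym_space by (rule triple_system.finite_points)

lemma edge_vector_in_free_space: "edge_vector n F \<in> free_space (points (double_sym_space n))"
  unfolding edge_vector_def by (intro point_vector_in_free_space finite_double_sym_points subset_refl)

lemma lookup_edge_vector:
  assumes F: "edge_function (F \<epsilon>)" and ab: "a \<in> {1..n+1}" "b \<in> {1..n+1}" and \<epsilon>: "\<epsilon> \<in> {1, -1}"
  shows "Poly_Mapping.lookup (edge_vector n F) (transpose a b, \<epsilon>) = F \<epsilon> a b"
proof (cases "a = b")
  case True
  then show ?thesis
    using edge_function_lookup[OF edge_vector_in_free_space, of n F \<epsilon>] F
    by (auto simp: edge_function_def dest: spec[of _ a])
next
  case False
  define c where "c = (SOME c. transpose a b c \<noteq> c)"
  have "transpose a b a \<noteq> a" using False by simp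
  then have "transpose a b c \<noteq> c" unfolding c_def by (rule someI)
  then have "c = a \<and> transpose a b c = b \<or> c = b \<and> transpose a b c = a"
    by (auto simp: transpose_def split: if_splits)
  then have "F \<epsilon> c (transpose a b c) = F \<epsilon> a b"
    using F by (auto simp: edge_function_def)
  moreover have "(transpose a b, \<epsilon>) \<in> points (double_sym_space n)"
    using ab \<epsilon> in_double_sym_points[OF False] by blast
  ultimately show ?thesis
    by (simp add: edge_vector_def lookup_point_vector finite_double_sym_points c_def Let_def)
qed

text \<open>
  The equation \<open>e v = \<mu> v\<close> in coordinates, with \<open>\<beta> = \<alpha>/2\<close> and the sums over \<open>d \<notin> {a, b}\<close> in the product
  formula written as full row sums minus the excluded terms.
\<close>

definition layer_eigenpair ::
  "nat \<Rightarrow> nat \<Rightarrow> 'f \<Rightarrow> 'f \<Rightarrow> 'f \<Rightarrow> 'f \<Rightarrow> (nat \<Rightarrow> nat \<Rightarrow> 'f) \<Rightarrow> (nat \<Rightarrow> nat \<Rightarrow> 'f::comm_ring_1) \<Rightarrow> bool" where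
  "layer_eigenpair n i k l \<beta> \<mu> p m \<longleftrightarrow> (\<forall>a\<in>{1..n+1}. \<forall>b\<in>{1..n+1}. a \<noteq> b \<longrightarrow>
     \<mu> * m a b = \<beta> * laplacian n (layer_weight i k l) m a b
   \<and> \<mu> * p a b = \<beta> * laplacian n (layer_weight i k l) p a b + layer_weight i k l a b *
       (p a b + \<beta> * (row_sum (n+1) p a + row_sum (n+1) p b + row_sum (n+1) m a + row_sum (n+1) m b
         - 2 * (p a b + m a b))))"

context
  fixes i n :: nat and \<alpha> k l :: "'f::field_char_0" and e :: "(nat \<Rightarrow> nat) \<times> int \<Rightarrow>\<^sub>0 'f"
  assumes i_less: "i < n"
    and e: "e \<in> free_space (points (double_sym_space n))"
    and e_pos: "\<And>a b. a \<in> {1..n+1} \<Longrightarrow> b \<in> {1..n+1} \<Longrightarrow> a \<noteq> b \<Longrightarrow>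
      Poly_Mapping.lookup e (transpose a b, 1) = layer_weight i k l a b"
    and e_neg: "\<And>x. Poly_Mapping.lookup e (x, -1) = 0"
begin

lemma layer_mult_eigen_iff:
  assumes v: "v \<in> free_space (points (double_sym_space n))"
  shows "matsuo_mult \<alpha> (double_sym_space n) e v = scale \<mu> v \<longleftrightarrow>
    layer_eigenpair n i k l (\<alpha> / 2) \<mu> (\<lambda>a b. Poly_Mapping.lookup v (transpose a b, 1))
      (\<lambda>a b. Poly_Mapping.lookup v (transpose a b, -1))"
proof -
  interpret D: triple_system "double_sym_space n" by (rule triple_system_double_sym_space)
  let ?p = "\<lambda>a b. Poly_Mapping.lookup v (transpose a b, 1)"
  let ?m = "\<lambda>a b. Poly_Mapping.lookup v (transpose a b, -1)"
  let ?w = "layer_weight i k l"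
  let ?e = "Poly_Mapping.lookup (matsuo_mult \<alpha> (double_sym_space n) e v)"
  have edge: "edge_function ?p" "edge_function ?m"
    using edge_function_lookup[OF v] by auto
  have minus: "?e (transpose a b, -1) = \<alpha> / 2 * laplacian n ?w ?m a b"
    and plus: "?e (transpose a b, 1) = \<alpha> / 2 * laplacian n ?w ?p a b + ?w a b *
       (?p a b + \<alpha> / 2 * (row_sum (n+1) ?p a + row_sum (n+1) ?p b + row_sum (n+1) ?m a + row_sum (n+1) ?m b
         - 2 * (?p a b + ?m a b)))"
    if ab: "a \<in> {1..n+1}" "b \<in> {1..n+1}" "a \<noteq> b" for a b
  proof -
    have lap: "laplacian n (\<lambda>a b. Poly_Mapping.lookup e (transpose a b, 1)) f a b = laplacian n ?w f a b" for f
      by (intro laplacian_cong ab refl) (rule e_pos)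
    show "?e (transpose a b, -1) = \<alpha> / 2 * laplacian n ?w ?m a b"
      using lookup_mult_plus_supported(1)[OF e v ab e_neg, of \<alpha>] lap by simp
    have "(\<Sum>d\<in>{1..n+1} - {a, b}. ?p a d + ?p b d + ?m a d + ?m b d) =
        (\<Sum>d\<in>{1..n+1} - {a, b}. ?p a d + ?p b d) + (\<Sum>d\<in>{1..n+1} - {a, b}. ?m a d + ?m b d)"
      by (simp add: sum.distrib)
    also have "\<dots> = row_sum (n+1) ?p a + row_sum (n+1) ?p b + row_sum (n+1) ?m a + row_sum (n+1) ?m b
         - 2 * (?p a b + ?m a b)"
      unfolding sum_remove_pair[OF i_less edge(1) ab] sum_remove_pair[OF i_less edge(2) ab]
      by (simp add: algebra_simps)
    finally have rows: "(\<Sum>d\<in>{1..n+1} - {a, b}. ?p a d + ?p b d + ?m a d + ?m b d) = \<dots>" .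
    show "?e (transpose a b, 1) = \<alpha> / 2 * laplacian n ?w ?p a b + ?w a b *
       (?p a b + \<alpha> / 2 * (row_sum (n+1) ?p a + row_sum (n+1) ?p b + row_sum (n+1) ?m a + row_sum (n+1) ?m b
         - 2 * (?p a b + ?m a b)))"
      using lookup_mult_plus_supported(2)[OF e v ab e_neg, of \<alpha>] e_pos[OF ab]
      unfolding lap rows by simp
  qed
  have "matsuo_mult \<alpha> (double_sym_space n) e v = scale \<mu> v \<longleftrightarrow>
      (\<forall>z\<in>points (double_sym_space n). \<mu> * Poly_Mapping.lookup v z = ?e z)"
  proof
    assume eq: "\<forall>z\<in>points (double_sym_space n). \<mu> * Poly_Mapping.lookup v z = ?e z"
    have "scale \<mu> v \<in> free_space (points (double_sym_space n))"
      using v by (simp add: free_space_lookup)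
    with eq show "matsuo_mult \<alpha> (double_sym_space n) e v = scale \<mu> v"
      by (intro D.free_space_eqI[OF D.matsuo_mult_closed[OF e v]]) auto
  qed simp
  also have "\<dots> \<longleftrightarrow> (\<forall>a\<in>{1..n+1}. \<forall>b\<in>{1..n+1}. a \<noteq> b \<longrightarrow>
      \<mu> * ?m a b = ?e (transpose a b, -1) \<and> \<mu> * ?p a b = ?e (transpose a b, 1))"
  proof (intro iffI ballI impI conjI)
    fix z assume eq: "\<forall>a\<in>{1..n+1}. \<forall>b\<in>{1..n+1}. a \<noteq> b \<longrightarrow>
      \<mu> * ?m a b = ?e (transpose a b, -1) \<and> \<mu> * ?p a b = ?e (transpose a b, 1)"
    assume "z \<in> points (double_sym_space n)"
    then show "\<mu> * Poly_Mapping.lookup v z = ?e z"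
      by (rule double_sym_pointE) (use eq in blast)
  qed (use in_double_sym_points in blast)+
  also have "\<dots> \<longleftrightarrow> layer_eigenpair n i k l (\<alpha> / 2) \<mu> ?p ?m"
    unfolding layer_eigenpair_def
  proof (intro ball_cong refl imp_cong)
    fix a b assume ab: "a \<in> {1..n+1}" "b \<in> {1..n+1}" "a \<noteq> b"
    show "(\<mu> * ?m a b = ?e (transpose a b, -1) \<and> \<mu> * ?p a b = ?e (transpose a b, 1)) \<longleftrightarrow>
      (\<mu> * ?m a b = \<alpha> / 2 * laplacian n ?w ?m a b
       \<and> \<mu> * ?p a b = \<alpha> / 2 * laplacian n ?w ?p a b + ?w a b *
         (?p a b + \<alpha> / 2 * (row_sum (n+1) ?p a + row_sum (n+1) ?p b + row_sum (n+1) ?m a + row_sum (n+1) ?m b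
           - 2 * (?p a b + ?m a b))))"
      unfolding minus[OF ab] plus[OF ab] by (rule refl)
  qed
  finally show ?thesis .
qed

lemma layer_eigenvalueI:
  assumes p: "edge_function p" and m: "edge_function m"
    and ab: "a \<in> {1..n+1}" "b \<in> {1..n+1}" "p a b \<noteq> 0 \<or> m a b \<noteq> 0"
    and eig: "layer_eigenpair n i k l (\<alpha> / 2) \<mu> p m"
  shows "\<mu> \<in> Spec \<alpha> (double_sym_space n) e"
proof -
  let ?F = "\<lambda>\<epsilon>::int. if \<epsilon> = 1 then p else m"
  let ?v = "edge_vector n ?F"
  have lookup: "Poly_Mapping.lookup ?v (transpose a b, 1) = p a b"
    "Poly_Mapping.lookup ?v (transpose a b, -1) = m a b"
    if "a \<in> {1..n+1}" "b \<in> {1..n+1}" for a b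
    using lookup_edge_vector[of ?F 1 a n b] lookup_edge_vector[of ?F "-1" a n b] p m that by auto
  have row: "row_sum (n+1) (\<lambda>a b. Poly_Mapping.lookup ?v (transpose a b, 1)) a = row_sum (n+1) p a"
    "row_sum (n+1) (\<lambda>a b. Poly_Mapping.lookup ?v (transpose a b, -1)) a = row_sum (n+1) m a"
    if "a \<in> {1..n+1}" for a
    unfolding row_sum_def using lookup[OF that] by (intro sum.cong refl; simp)+
  have lap: "laplacian n w (\<lambda>a b. Poly_Mapping.lookup ?v (transpose a b, 1)) a b = laplacian n w p a b"
    "laplacian n w (\<lambda>a b. Poly_Mapping.lookup ?v (transpose a b, -1)) a b = laplacian n w m a b"
    if "a \<in> {1..n+1}" "b \<in> {1..n+1}" "a \<noteq> b" for a b w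
    using lookup that by (intro laplacian_cong; simp)+
  have "matsuo_mult \<alpha> (double_sym_space n) e ?v = scale \<mu> ?v"
    unfolding layer_mult_eigen_iff[OF edge_vector_in_free_space] layer_eigenpair_def
  proof (intro ballI impI)
    fix a b assume ab: "a \<in> {1..n+1}" "b \<in> {1..n+1}" "a \<noteq> b"
    show "\<mu> * Poly_Mapping.lookup ?v (transpose a b, -1) = \<alpha> / 2 * laplacian n (layer_weight i k l)
          (\<lambda>a b. Poly_Mapping.lookup ?v (transpose a b, -1)) a b
      \<and> \<mu> * Poly_Mapping.lookup ?v (transpose a b, 1) = \<alpha> / 2 * laplacian n (layer_weight i k l)
          (\<lambda>a b. Poly_Mapping.lookup ?v (transpose a b, 1)) a b + layer_weight i k l a b *
         (Poly_Mapping.lookup ?v (transpose a b, 1) + \<alpha> / 2 *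
           (row_sum (n+1) (\<lambda>a b. Poly_Mapping.lookup ?v (transpose a b, 1)) a
            + row_sum (n+1) (\<lambda>a b. Poly_Mapping.lookup ?v (transpose a b, 1)) b
            + row_sum (n+1) (\<lambda>a b. Poly_Mapping.lookup ?v (transpose a b, -1)) a
            + row_sum (n+1) (\<lambda>a b. Poly_Mapping.lookup ?v (transpose a b, -1)) b
            - 2 * (Poly_Mapping.lookup ?v (transpose a b, 1) + Poly_Mapping.lookup ?v (transpose a b, -1))))"
      unfolding lookup[OF ab(1,2)] row[OF ab(1)] row[OF ab(2)] lap[OF ab]
      using eig ab unfolding layer_eigenpair_def by blast
  qed
  moreover have "?v \<noteq> 0"
    using lookup[OF ab(1,2)] ab(3) by auto
  ultimately show ?thesis
    unfolding Spec_def using edge_vector_in_free_space by blast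
qed

lemma layer_eigenvalueE:
  assumes "\<mu> \<in> Spec \<alpha> (double_sym_space n) e"
  obtains p m a b where "edge_function p" "edge_function m"
    "a \<in> {1..n+1}" "b \<in> {1..n+1}" "p a b \<noteq> 0 \<or> m a b \<noteq> 0"
    "layer_eigenpair n i k l (\<alpha> / 2) \<mu> p m"
proof -
  obtain v where v: "v \<in> free_space (points (double_sym_space n))" "v \<noteq> 0"
    and eig: "matsuo_mult \<alpha> (double_sym_space n) e v = scale \<mu> v"
    using assms by (auto simp: Spec_def)
  obtain z where z: "Poly_Mapping.lookup v z \<noteq> 0"
    using v(2) by (metis lookup_zero poly_mapping_eqI)
  then have "z \<in> points (double_sym_space n)"
    using v(1) unfolding free_space_lookup by blast
  then obtain a b \<epsilon> where "a \<in> {1..n+1}" "b \<in> {1..n+1}" "\<epsilon> \<in> {1, -1}" "z = (transpose a b, \<epsilon>)"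
    by (rule double_sym_pointE)
  with z that[OF edge_function_lookup[OF v(1)] edge_function_lookup[OF v(1)]] layer_mult_eigen_iff[OF v(1)] eig
  show thesis by blast
qed

end

text \<open>
  Outside the listed values the equation forces \<open>m = 0\<close>, which decouples \<open>p\<close>; then \<open>p\<close> vanishes on
  edges with an outer letter for the same reason as \<open>m\<close>, which leaves a vector of the
  subalgebra of \<open>\<A>\<^sub>i\<close>.
\<close>

lemma layer_eigenpair_subset:
  fixes k l \<beta> \<mu> :: "'f::field_char_0"
  assumes i: "i < n" "2 \<le> i" and p: "edge_function p" and m: "edge_function m"
    and k: "k * (1 + 2 * \<beta> * (of_nat i - 1)) = 1" and l: "l * (1 + 2 * \<beta> * (of_nat i - 2)) = 1"
    and eig: "layer_eigenpair n i k l \<beta> \<mu> p m"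
    and ab: "a \<in> {1..n+1}" "b \<in> {1..n+1}" "p a b \<noteq> 0 \<or> m a b \<noteq> 0"
  shows "\<mu> \<in> {0, 1, \<beta> * (k * (of_nat i + 1)), 1 - \<beta> * l * of_nat i,
    \<beta> * (k * (of_nat i + 1) - l * of_nat i), \<beta> * (2 * k * of_nat i - l * of_nat i),
    \<beta> * (2 * k * of_nat i - 2 * l * (of_nat i - 1))}"
proof (rule ccontr)
  assume neg: "\<not> ?thesis"
  have sym: "p a b = p b a" "m a b = m b a" for a b
    using p m unfolding edge_function_def by blast+
  have eig_m: "\<mu> * m a b = \<beta> * laplacian n (layer_weight i k l) m a b"
    and eig_p: "\<mu> * p a b = \<beta> * laplacian n (layer_weight i k l) p a b + layer_weight i k l a b *
       (p a b + \<beta> * (row_sum (n+1) p a + row_sum (n+1) p b + row_sum (n+1) m a + row_sum (n+1) m b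
         - 2 * (p a b + m a b)))"
    if "a \<in> {1..n+1}" "b \<in> {1..n+1}" "a \<noteq> b" for a b
    using eig that unfolding layer_eigenpair_def by blast+
  have inside: "a \<in> {1..n+1}" if "a \<in> {1..i+1}" for a
    using that i by auto
  have m_out: "m a b = 0" if "a \<in> {1..n+1}" "b \<in> {1..n+1}" "Suc i < b" for a b
    by (rule outer_eigenfunction_zero[OF i m, where \<mu> = \<mu> and \<beta> = \<beta> and k = k and l = l])
       (use neg that eig_m in auto)
  have m_in: "m a b = 0" if "a \<in> {1..i+1}" "b \<in> {1..i+1}" for a b
    by (rule inner_eigenfunction_zero[OF i m, where \<mu> = \<mu> and \<beta> = \<beta> and k = k and l = l])
       (use neg that eig_m inside in auto)
  have m0: "m a b = 0" if "a \<in> {1..n+1}" "b \<in> {1..n+1}" for a b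
    using m_out[of a b] m_out[of b a] m_in[of a b] that sym(2)[of a b]
    by (cases "Suc i < a"; cases "Suc i < b") auto
  have row0: "row_sum (n+1) m a = 0" if "a \<in> {1..n+1}" for a
    unfolding row_sum_def by (intro sum.neutral ballI m0 that)
  have p_out: "p a b = 0" if "a \<in> {1..n+1}" "b \<in> {1..n+1}" "Suc i < b" for a b
  proof (rule outer_eigenfunction_zero[OF i p, where \<mu> = \<mu> and \<beta> = \<beta> and k = k and l = l])
    fix a b assume "a \<in> {1..n+1}" "b \<in> {1..n+1}" "a \<noteq> b" "Suc i < b"
    then show "\<mu> * p a b = \<beta> * laplacian n (layer_weight i k l) p a b"
      using eig_p[of a b] by (simp add: layer_weight_simps)
  qed (use neg that in auto)
  \<comment> \<open>Only the values of \<open>p\<close> on the letters enter the eigenvalue equation, but the vanishing lemma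
    below asks for zeros at every outer letter; hence the truncation.\<close>
  define q where "q a b = (if a \<in> {1..n+1} \<and> b \<in> {1..n+1} then p a b else 0)" for a b
  have q: "edge_function q"
    using p unfolding edge_function_def q_def by simp
  have q_eq: "q a b = p a b" if "a \<in> {1..n+1}" "b \<in> {1..n+1}" for a b
    using that by (simp add: q_def)
  have q_in: "q a b = 0" if "a \<in> {1..i+1}" "b \<in> {1..i+1}" for a b
  proof (rule subalgebra_eigenvector_zero[OF i q _ k l, where \<mu> = \<mu>])
    show "q a b = 0" if "Suc i < b" for a b
      using p_out that by (auto simp: q_def)
    fix a b assume ab: "a \<in> {1..i+1}" "b \<in> {1..i+1}" "a \<noteq> b"
    note N = inside[OF ab(1)] inside[OF ab(2)]
    have "laplacian n (layer_weight i k l) q a b = laplacian n (layer_weight i k l) p a b"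
      by (rule laplacian_cong[OF q_eq refl N ab(3)])
    moreover have "row_sum (n+1) q a = row_sum (n+1) p a" if "a \<in> {1..n+1}" for a
      unfolding row_sum_def by (intro sum.cong refl q_eq that)
    ultimately show "\<mu> * q a b = \<beta> * laplacian n (layer_weight i k l) q a b + layer_weight i k l a b *
        (q a b + \<beta> * (row_sum (n+1) q a + row_sum (n+1) q b - 2 * q a b))"
      using eig_p[OF N ab(3)] N row0 m0 q_eq by simp
  qed (use neg that in auto)
  have "p a b = 0"
    using p_out[of a b] p_out[of b a] q_in[of a b] q_eq[of a b] ab sym(1)[of a b]
    by (cases "Suc i < a"; cases "Suc i < b") auto
  with m0 ab show False by blast
qed

lemma laplacian_commute:
  assumes "edge_function f"
  shows "laplacian n w f a b = laplacian n w f b a"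
proof -
  have "f a b = f b a" using assms by (simp add: edge_function_def)
  then show ?thesis unfolding laplacian_def by (simp add: insert_commute add.commute)
qed

lemma laplacian_eigenI:
  fixes k l \<beta> \<mu> :: "'f::comm_ring_1"
  assumes i: "i < n" and f: "edge_function f"
    and outer_outer: "\<And>a b. Suc i < a \<Longrightarrow> Suc i < b \<Longrightarrow> \<mu> * f a b = 0"
    and inner_outer: "\<And>a b. a \<in> {1..i} \<Longrightarrow> Suc i < b \<Longrightarrow>
      \<mu> * f a b = \<beta> * ((k - l) * (of_nat i * f a b - row_sum i f b) + k * (f a b - f (Suc i) b))"
    and top_outer: "\<And>b. Suc i < b \<Longrightarrow>
      \<mu> * f (Suc i) b = \<beta> * (k * (of_nat i * f (Suc i) b - row_sum i f b))"
    and inner_top: "\<And>a. a \<in> {1..i} \<Longrightarrow> \<mu> * f a (Suc i) =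
      \<beta> * ((k - l) * (of_nat i * f a (Suc i) - row_sum i f (Suc i))
        + k * ((of_nat i - 1) * f a (Suc i) - row_sum i f a))"
    and inner_inner: "\<And>a b. a \<in> {1..i} \<Longrightarrow> b \<in> {1..i} \<Longrightarrow> a \<noteq> b \<Longrightarrow> \<mu> * f a b =
      \<beta> * ((k - l) * ((2 * of_nat i - 2) * f a b - row_sum i f a - row_sum i f b)
        + k * (2 * f a b - f a (Suc i) - f b (Suc i)))"
    and ab: "a \<in> {1..n+1}" "b \<in> {1..n+1}" "a \<noteq> b"
  shows "\<mu> * f a b = \<beta> * laplacian n (layer_weight i k l) f a b"
proof -
  have *: "\<mu> * f a b = \<beta> * laplacian n (layer_weight i k l) f a b"
    if "a \<in> {1..n+1}" "b \<in> {1..n+1}" "a < b" for a b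
  proof -
    note range = that
    consider "a \<in> {1..i}" "b \<in> {1..i}" | "a \<in> {1..i}" "b = Suc i" | "a \<in> {1..i}" "Suc i < b"
      | "a = Suc i" "Suc i < b" | "Suc i < a" "Suc i < b"
      using range by (cases "a \<le> i"; cases "b \<le> i"; cases "a = Suc i"; cases "b = Suc i") auto
    then show ?thesis
    proof cases
      case 1 with inner_inner[of a b] laplacian_inner_inner[OF i f 1, of k l] range show ?thesis by simp
    next
      case 2 with inner_top[of a] laplacian_inner_top[OF i f 2(1), of k l] show ?thesis by simp
    next
      case 3 with inner_outer[of a b] laplacian_inner_outer[OF i f 3, of k l] show ?thesis by simp
    next
      case 4 with top_outer[of b] laplacian_top_outer[OF i f 4(2), of k l] show ?thesis by simp
    next
      case 5 with outer_outer[of a b] laplacian_outer_outer[OF i f 5, of k l] show ?thesis by simp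
    qed
  qed
  show ?thesis
  proof (cases "a < b")
    case True then show ?thesis using * ab by blast
  next
    case False
    then have "\<mu> * f b a = \<beta> * laplacian n (layer_weight i k l) f b a"
      using * ab by simp
    then show ?thesis
      using laplacian_commute[OF f] f unfolding edge_function_def by metis
  qed
qed

text \<open>
  For \<open>m = - p\<close> the row sums in the coupling cancel. What is left of the coupling is a multiple of
  \<open>p\<close> on edges inside \<open>{1..i+1}\<close>, where \<open>p\<close> is zero.
\<close>

lemma antisymmetric_eigenpair:
  fixes k l \<beta> \<mu> :: "'f::comm_ring_1"
  assumes eig: "\<And>a b. a \<in> {1..n+1} \<Longrightarrow> b \<in> {1..n+1} \<Longrightarrow> a \<noteq> b \<Longrightarrow>
      \<mu> * f a b = \<beta> * laplacian n (layer_weight i k l) f a b"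
    and inside: "\<And>a b. a \<le> Suc i \<Longrightarrow> b \<le> Suc i \<Longrightarrow> f a b = 0"
  shows "layer_eigenpair n i k l \<beta> \<mu> f (\<lambda>a b. - f a b)"
proof -
  have "laplacian n w (\<lambda>a b. - f a b) a b = - laplacian n w f a b" for w a b
    using laplacian_scale[of n w "-1" f a b] by simp
  moreover have "row_sum (n+1) (\<lambda>a b. - f a b) a = - row_sum (n+1) f a" for a
    by (simp add: row_sum_def sum_negf)
  moreover have "layer_weight i k l a b * f a b = 0" for a b
    using inside by (simp add: layer_weight_def)
  ultimately show ?thesis
    using eig by (simp add: layer_eigenpair_def)
qed

text \<open>
  Without row sums the coupling is the weight times \<open>p - 2 \<beta> (p + m)\<close>. It vanishes for
  \<open>p : m = 2 \<beta> : (1 - 2 \<beta>)\<close>, so every eigenfunction of the Laplacian with zero row sums lifts to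
  an eigenvector.
\<close>

lemma degree_zero_eigenpair:
  fixes k l \<beta> \<mu> :: "'f::comm_ring_1"
  assumes eig: "\<And>a b. a \<in> {1..n+1} \<Longrightarrow> b \<in> {1..n+1} \<Longrightarrow> a \<noteq> b \<Longrightarrow>
      \<mu> * f a b = \<beta> * laplacian n (layer_weight i k l) f a b"
    and deg: "\<And>a. a \<in> {1..n+1} \<Longrightarrow> row_sum (n+1) f a = 0"
  shows "layer_eigenpair n i k l \<beta> \<mu> (\<lambda>a b. 2 * \<beta> * f a b) (\<lambda>a b. (1 - 2 * \<beta>) * f a b)"
proof -
  have row: "row_sum (n+1) (\<lambda>a b. c * f a b) a = 0" if "a \<in> {1..n+1}" for a c
    using deg[OF that] by (simp add: row_sum_def sum_distrib_left[symmetric] del: sum.cl_ivl_Suc)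
  have "\<mu> * (c * f a b) = \<beta> * (c * laplacian n (layer_weight i k l) f a b)"
    if "a \<in> {1..n+1}" "b \<in> {1..n+1}" "a \<noteq> b" for a b c
    using eig[OF that] by (metis mult.left_commute)
  moreover have "2 * \<beta> * x + \<beta> * (0 - 2 * (2 * \<beta> * x + (1 - 2 * \<beta>) * x)) = 0" for x
    by (simp add: algebra_simps)
  ultimately show ?thesis
    unfolding layer_eigenpair_def laplacian_scale using row by auto
qed

section \<open>Explicit eigenfunctions\<close>

text \<open>
  Supported on the edges from \<open>{1..i+1}\<close> to the single outer letter \<open>i+2\<close>, which exists as \<open>i < n\<close>.
\<close>

definition outer_star :: "nat \<Rightarrow> (nat \<Rightarrow> 'f) \<Rightarrow> nat \<Rightarrow> nat \<Rightarrow> 'f::zero" where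
  "outer_star i \<psi> a b = (if b = i + 2 \<and> a \<le> i + 1 then \<psi> a
     else if a = i + 2 \<and> b \<le> i + 1 then \<psi> b else 0)"

lemma outer_star_eigenpair:
  fixes k l \<beta> \<mu> :: "'f::comm_ring_1"
  assumes i: "i < n"
    and inner: "\<And>a. a \<in> {1..i} \<Longrightarrow>
      \<mu> * \<psi> a = \<beta> * ((k - l) * (of_nat i * \<psi> a - (\<Sum>d\<in>{1..i}. \<psi> d)) + k * (\<psi> a - \<psi> (Suc i)))"
    and top: "\<mu> * \<psi> (Suc i) = \<beta> * (k * (of_nat i * \<psi> (Suc i) - (\<Sum>d\<in>{1..i}. \<psi> d)))"
  shows "layer_eigenpair n i k l \<beta> \<mu> (outer_star i \<psi>) (\<lambda>a b. - outer_star i \<psi> a b)"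
proof (rule antisymmetric_eigenpair)
  show "outer_star i \<psi> a b = 0" if "a \<le> Suc i" "b \<le> Suc i" for a b
    using that by (auto simp: outer_star_def)
  have row: "row_sum i (outer_star i \<psi>) b = (if b = i + 2 then \<Sum>d\<in>{1..i}. \<psi> d else 0)" for b
    by (auto simp: row_sum_def outer_star_def intro!: sum.cong sum.neutral)
  have edge: "edge_function (outer_star i \<psi>)"
    by (auto simp: edge_function_def outer_star_def)
  show "\<mu> * outer_star i \<psi> a b = \<beta> * laplacian n (layer_weight i k l) (outer_star i \<psi>) a b"
    if "a \<in> {1..n+1}" "b \<in> {1..n+1}" "a \<noteq> b" for a b
    by (rule laplacian_eigenI[OF i edge _ _ _ _ _ that])
       (auto simp: row outer_star_def inner top)
qed

lemma edge_function_outer_star: "edge_function (outer_star i \<psi>)"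
  by (auto simp: edge_function_def outer_star_def)

definition unit_difference :: "nat \<Rightarrow> 'f::ring_1" where
  "unit_difference a = of_bool (a = 1) - of_bool (a = 2)"

lemma sum_unit_difference: "2 \<le> i \<Longrightarrow> (\<Sum>d\<in>{1..i}. unit_difference d) = (0::'f::ring_1)"
  by (simp add: unit_difference_def sum_subtractf of_bool_def)

text \<open>
  The edges to the top letter carry \<open>unit_difference\<close>, which changes sign under \<open>(1,2)\<close> and is
  invariant under the permutations of \<open>3..i\<close>. Up to the factor \<open>s\<close>, the values on inner edges are the
  only ones with the same behaviour.
\<close>

definition star :: "nat \<Rightarrow> 'f \<Rightarrow> nat \<Rightarrow> nat \<Rightarrow> 'f::ring_1" where
  "star i s a b = (if a = b \<or> Suc i < a \<or> Suc i < b then 0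
     else if b = Suc i then unit_difference a else if a = Suc i then unit_difference b else s * (unit_difference a + unit_difference b))"

lemma edge_function_star: "edge_function (star i s)"
  by (auto simp: edge_function_def star_def add.commute)

lemma row_star:
  fixes s :: "'f::comm_ring_1"
  assumes "2 \<le> i"
  shows "a \<in> {1..i} \<Longrightarrow> row_sum i (star i s) a = s * (of_nat i - 2) * unit_difference a"
    and "row_sum i (star i s) (Suc i) = 0"
    and "Suc i < a \<Longrightarrow> row_sum i (star i s) a = 0"
proof -
  assume a: "a \<in> {1..i}"
  have "row_sum i (star i s) a = (\<Sum>d\<in>{1..i} - {a}. s * (unit_difference a + unit_difference d))"
    unfolding row_sum_def using a
    by (subst sum.remove[of _ a]) (auto simp: star_def intro!: sum.cong)
  also have "\<dots> = (\<Sum>d\<in>{1..i}. s * (unit_difference a + unit_difference d)) - s * (unit_difference a + unit_difference a)"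
    using a by (intro sum_remove1) auto
  also have "(\<Sum>d\<in>{1..i}. s * (unit_difference a + unit_difference d)) = s * (of_nat i * unit_difference a)"
    unfolding sum_distrib_left[symmetric] sum.distrib sum_unit_difference[OF assms] by simp
  finally show "row_sum i (star i s) a = s * (of_nat i - 2) * unit_difference a"
    by (simp add: algebra_simps)
next
  have "row_sum i (star i s) (Suc i) = (\<Sum>d\<in>{1..i}. unit_difference d)"
    unfolding row_sum_def by (intro sum.cong) (auto simp: star_def)
  then show "row_sum i (star i s) (Suc i) = 0" using sum_unit_difference[OF assms] by simp
next
  assume "Suc i < a" then show "row_sum i (star i s) a = 0" by (simp add: row_sum_def star_def)
qed

text \<open>
  The parameter \<open>s = - 1 / (i - 2)\<close> is the one for which all row sums vanish.
\<close>

lemma star_degree_zero_eigenpair: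
  fixes k l \<beta> :: "'f::field_char_0"
  assumes i: "i < n" "3 \<le> i"
  defines "f \<equiv> star i (- 1 / (of_nat i - 2)) :: nat \<Rightarrow> nat \<Rightarrow> 'f"
  shows "layer_eigenpair n i k l \<beta> (\<beta> * (2 * k * of_nat i - l * of_nat i))
    (\<lambda>a b. 2 * \<beta> * f a b) (\<lambda>a b. (1 - 2 * \<beta>) * f a b)"
proof (rule degree_zero_eigenpair)
  have i2: "2 \<le> i" and nz: "(of_nat i - 2 :: 'f) \<noteq> 0"
  proof -
    have "(of_nat i :: 'f) \<noteq> of_nat 2" using i(2) unfolding of_nat_eq_iff by simp
    then show "(of_nat i - 2 :: 'f) \<noteq> 0" by simp
  qed (use i in simp)
  have edge: "edge_function f" unfolding f_def by (rule edge_function_star)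
  have row_in: "row_sum i f a = - unit_difference a" if "a \<in> {1..i}" for a
    using row_star(1)[OF i2 that, of "- 1 / (of_nat i - 2) :: 'f"] nz by (simp add: f_def)
  have row_top: "row_sum i f (Suc i) = 0" and row_out: "Suc i < a \<Longrightarrow> row_sum i f a = 0" for a
    unfolding f_def using row_star(2,3)[OF i2] by auto
  have f_top: "f a (Suc i) = unit_difference a" "f (Suc i) a = unit_difference a" if "a \<in> {1..i}" for a
    using that by (auto simp: f_def star_def)
  have f_out: "f a b = 0" if "Suc i < b" for a b
    using that by (auto simp: f_def star_def)
  have f_in: "unit_difference a + unit_difference b = - (of_nat i - 2) * f a b" if "a \<in> {1..i}" "b \<in> {1..i}" "a \<noteq> b" for a b
  proof -
    have cancel: "- c * (- 1 / c * y) = y" if "c \<noteq> 0" for c y :: 'f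
      using that by simp
    have "f a b = - 1 / (of_nat i - 2) * (unit_difference a + unit_difference b)"
      using that unfolding f_def star_def by simp
    then show ?thesis by (simp only: cancel[OF nz])
  qed
  show "row_sum (n+1) f a = 0" if "a \<in> {1..n+1}" for a
  proof -
    have "row_sum (n+1) f a = row_sum i f a + f a (Suc i)"
      using row_inner[OF i(1) edge] f_out by blast
    also have "\<dots> = 0"
    proof -
      consider "a \<in> {1..i}" | "a = Suc i" | "Suc i < a" using \<open>a \<in> {1..n+1}\<close> by force
      then show ?thesis
        by cases (use row_in row_top row_out f_top in \<open>auto simp: f_def star_def\<close>)
    qed
    finally show ?thesis .
  qed
  show "\<beta> * (2 * k * of_nat i - l * of_nat i) * f a b = \<beta> * laplacian n (layer_weight i k l) f a b"
    if "a \<in> {1..n+1}" "b \<in> {1..n+1}" "a \<noteq> b" for a b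
  proof (rule laplacian_eigenI[OF i(1) edge _ _ _ _ _ that])
    fix a b
    show "\<beta> * (2 * k * of_nat i - l * of_nat i) * f a b = 0" if "Suc i < a" "Suc i < b"
      using f_out[OF that(2)] by simp
    show "\<beta> * (2 * k * of_nat i - l * of_nat i) * f a b
        = \<beta> * ((k - l) * (of_nat i * f a b - row_sum i f b) + k * (f a b - f (Suc i) b))"
      if "a \<in> {1..i}" "Suc i < b"
      using f_out[OF that(2)] row_out[OF that(2)] by simp
    show "\<beta> * (2 * k * of_nat i - l * of_nat i) * f (Suc i) b
        = \<beta> * (k * (of_nat i * f (Suc i) b - row_sum i f b))" if "Suc i < b"
      using f_out[OF that] row_out[OF that] by simp
    show "\<beta> * (2 * k * of_nat i - l * of_nat i) * f a (Suc i)
        = \<beta> * ((k - l) * (of_nat i * f a (Suc i) - row_sum i f (Suc i))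
          + k * ((of_nat i - 1) * f a (Suc i) - row_sum i f a))" if "a \<in> {1..i}"
      unfolding f_top[OF that] row_in[OF that] row_top by (simp add: algebra_simps)
    show "\<beta> * (2 * k * of_nat i - l * of_nat i) * f a b
        = \<beta> * ((k - l) * ((2 * of_nat i - 2) * f a b - row_sum i f a - row_sum i f b)
          + k * (2 * f a b - f a (Suc i) - f b (Suc i)))"
      if ab: "a \<in> {1..i}" "b \<in> {1..i}" "a \<noteq> b"
    proof -
      have "(k - l) * ((2 * of_nat i - 2) * f a b - row_sum i f a - row_sum i f b)
          + k * (2 * f a b - f a (Suc i) - f b (Suc i)) =
          (2 * k * of_nat i - 2 * l * (of_nat i - 1)) * f a b - l * (unit_difference a + unit_difference b)"
        unfolding f_top(1)[OF ab(1)] f_top(1)[OF ab(2)] row_in[OF ab(1)] row_in[OF ab(2)]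
        by (simp add: algebra_simps)
      also have "\<dots> = (2 * k * of_nat i - l * of_nat i) * f a b"
        unfolding f_in[OF ab] by (simp add: algebra_simps)
      finally show ?thesis by simp
    qed
  qed
qed

text \<open>
  In the subalgebra of \<open>\<A>\<^sub>i\<close> the operator is \<open>1 - id\<^bsub>i-1\<^esub>\<close>. It sends the edges to the top letter to \<open>\<mu>\<close>
  times themselves plus the inner part \<open>- \<beta> l (\<gamma> a + \<gamma> b)\<close>, \<open>\<gamma>\<close> being \<open>unit_difference\<close>, and kills
  inner edges; the parameter \<open>s\<close> is determined by \<open>\<mu> s = - \<beta> l\<close>.
\<close>

lemma star_subalgebra_eigenpair:
  fixes k l \<beta> :: "'f::field_char_0"
  assumes i: "i < n" "2 \<le> i"
    and k: "k * (1 + 2 * \<beta> * (of_nat i - 1)) = 1" and l: "l * (1 + 2 * \<beta> * (of_nat i - 2)) = 1"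
  defines "\<mu> \<equiv> 1 - \<beta> * l * of_nat i"
  assumes \<mu>: "\<mu> \<noteq> 0"
  shows "layer_eigenpair n i k l \<beta> \<mu> (star i (- \<beta> * l / \<mu>)) (\<lambda>_ _. 0)"
proof -
  define f :: "nat \<Rightarrow> nat \<Rightarrow> 'f" where "f = star i (- \<beta> * l / \<mu>)"
  have edge: "edge_function f" unfolding f_def by (rule edge_function_star)
  define s where "s = - \<beta> * l / \<mu>"
  have s: "\<mu> * s = - \<beta> * l" using \<mu> by (simp add: s_def)
  have row_in: "row_sum i f a = s * (of_nat i - 2) * unit_difference a" if "a \<in> {1..i}" for a
    unfolding f_def s_def by (rule row_star(1)[OF i(2) that])
  have row_top: "row_sum i f (Suc i) = 0" and row_out: "Suc i < a \<Longrightarrow> row_sum i f a = 0" for a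
    unfolding f_def using row_star(2,3)[OF i(2)] by auto
  have f_top: "f a (Suc i) = unit_difference a" if "a \<in> {1..i}" for a
    using that by (auto simp: f_def star_def)
  have f_out: "f a b = 0" if "Suc i < b" for a b
    using that by (auto simp: f_def star_def)
  have f_diag: "f a a = 0" for a by (simp add: f_def star_def)
  have f_in: "f a b = s * (unit_difference a + unit_difference b)" if "a \<in> {1..i}" "b \<in> {1..i}" "a \<noteq> b" for a b
    using that by (auto simp: f_def s_def star_def)
  have row: "row_sum (n+1) f a = row_sum i f a + f a (Suc i)" for a
    using row_inner[OF i(1) edge] f_out by blast
  let ?P = "\<lambda>a b. \<mu> * f a b = \<beta> * laplacian n (layer_weight i k l) f a b + layer_weight i k l a b *
       (f a b + \<beta> * (row_sum (n+1) f a + row_sum (n+1) f b - 2 * f a b))"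
  have sym: "?P a b \<longleftrightarrow> ?P b a" for a b
  proof -
    have "f a b = f b a" "layer_weight i k l a b = layer_weight i k l b a"
      using edge by (auto simp: edge_function_def layer_weight_def)
    then show ?thesis using laplacian_commute[OF edge, of n _ a b] by (simp add: add.commute add.left_commute)
  qed
  have P: "?P a b" if range: "a \<in> {1..n+1}" "b \<in> {1..n+1}" "a < b" for a b
  proof -
    consider "Suc i < b" "a \<le> i" | "Suc i < b" "a = Suc i" | "Suc i < b" "Suc i < a" | "a \<in> {1..i}" "b \<in> {1..i}" | "a \<in> {1..i}" "b = Suc i"
      using range by (cases "a \<le> i"; cases "b \<le> i"; cases "a = Suc i"; cases "b = Suc i") auto
    then show ?thesis
    proof cases
      case 1
      then have "laplacian n (layer_weight i k l) f a b = 0"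
        using laplacian_inner_outer[OF i(1) edge, of a b k l] range f_out row_out by simp
      with 1 f_out show ?thesis by (simp add: layer_weight_simps)
    next
      case 2
      then have "laplacian n (layer_weight i k l) f a b = 0"
        using laplacian_top_outer[OF i(1) edge, of b k l] f_out row_out by simp
      with 2 f_out show ?thesis by (simp add: layer_weight_simps)
    next
      case 3
      then have "laplacian n (layer_weight i k l) f a b = 0"
        using laplacian_outer_outer[OF i(1) edge, of a b k l] by simp
      with 3 f_out show ?thesis by (simp add: layer_weight_simps)
    next
      case 4
      then have w: "layer_weight i k l a b = k - l" using range by (simp add: layer_weight_simps)
      have ne: "a \<noteq> b" using range by simp
      have "\<beta> * laplacian n (layer_weight i k l) f a b + layer_weight i k l a b *
          (f a b + \<beta> * (row_sum (n+1) f a + row_sum (n+1) f b - 2 * f a b))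
        = (k * (1 + 2 * \<beta> * (of_nat i - 1)) - l * (1 + 2 * \<beta> * (of_nat i - 2))) * f a b
          - \<beta> * l * (unit_difference a + unit_difference b)"
        unfolding laplacian_inner_inner[OF i(1) edge 4 ne] w row f_top[OF 4(1)] f_top[OF 4(2)]
        by (simp add: algebra_simps)
      also have "\<dots> = \<mu> * s * (unit_difference a + unit_difference b)"
        unfolding k l s by (simp add: algebra_simps)
      also have "\<dots> = \<mu> * f a b" unfolding f_in[OF 4 ne] by simp
      finally show ?thesis by simp
    next
      case 5
      then have w: "layer_weight i k l a b = k" by (simp add: layer_weight_simps)
      have "\<beta> * laplacian n (layer_weight i k l) f a b + layer_weight i k l a b *
          (f a b + \<beta> * (row_sum (n+1) f a + row_sum (n+1) f b - 2 * f a b))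
        = (k * (1 + 2 * \<beta> * (of_nat i - 1)) - \<beta> * l * of_nat i) * unit_difference a"
        unfolding 5(2) laplacian_inner_top[OF i(1) edge 5(1)] w[unfolded 5(2)] row f_top[OF 5(1)] row_top f_diag
        by (simp add: algebra_simps)
      also have "\<dots> = \<mu> * f a b" unfolding k 5(2) f_top[OF 5(1)] \<mu>_def ..
      finally show ?thesis by simp
    qed
  qed
  have "?P a b" if "a \<in> {1..n+1}" "b \<in> {1..n+1}" "a \<noteq> b" for a b
    using P sym that by (metis linorder_neqE_nat)
  moreover have "laplacian n w (\<lambda>_ _. 0) a b = (0::'f)" "row_sum (n+1) (\<lambda>_ _. 0::'f) a = 0" for w a b
    by (simp_all add: laplacian_def row_sum_def)
  ultimately show ?thesis
    unfolding layer_eigenpair_def f_def[symmetric] by simp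
qed

text \<open>
  The signed four-cycle with value \<open>1\<close> on \<open>{1,2}\<close>, \<open>{3,4}\<close> and \<open>-1\<close> on \<open>{1,3}\<close>, \<open>{2,4}\<close>, as a
  symmetrised product so that its row sums visibly vanish. It needs four inner letters,
  whence \<open>i \<ge> 4\<close>.
\<close>

definition four_cycle :: "nat \<Rightarrow> nat \<Rightarrow> 'f::comm_ring_1" where
  "four_cycle a b = (of_bool (a = 1) - of_bool (a = 4)) * (of_bool (b = 2) - of_bool (b = 3))
    + (of_bool (b = 1) - of_bool (b = 4)) * (of_bool (a = 2) - of_bool (a = 3))"

lemma edge_function_four_cycle: "edge_function four_cycle"
  by (auto simp: edge_function_def four_cycle_def)

lemma row_four_cycle:
  assumes "4 \<le> j"
  shows "row_sum j four_cycle a = (0::'f::comm_ring_1)"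
proof -
  have "(\<Sum>d\<in>{1..j}. of_bool (d = 2) - of_bool (d = 3)) = (0::'f)"
    "(\<Sum>d\<in>{1..j}. of_bool (d = 1) - of_bool (d = 4)) = (0::'f)"
    using assms by (simp_all add: sum_subtractf of_bool_def)
  then show ?thesis
    unfolding row_sum_def four_cycle_def sum.distrib sum_distrib_left[symmetric] sum_distrib_right[symmetric]
    by simp
qed

lemma four_cycle_eigenpair:
  fixes k l \<beta> :: "'f::field_char_0"
  assumes i: "i < n" "4 \<le> i"
  shows "layer_eigenpair n i k l \<beta> (\<beta> * (2 * k * of_nat i - 2 * l * (of_nat i - 1)))
    (\<lambda>a b. 2 * \<beta> * four_cycle a b) (\<lambda>a b. (1 - 2 * \<beta>) * four_cycle a b)"
proof (rule degree_zero_eigenpair)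
  show "row_sum (n+1) four_cycle a = (0::'f)" for a
    using i by (intro row_four_cycle) simp
  have out: "four_cycle a b = (0::'f)" if "i < b" for a b
    using i that by (simp add: four_cycle_def)
  have out': "four_cycle a b = (0::'f)" if "i < a" for a b
    using i that by (simp add: four_cycle_def)
  have row: "row_sum i four_cycle a = (0::'f)" for a
    using i(2) by (rule row_four_cycle)
  fix a b assume ab: "a \<in> {1..n+1}" "b \<in> {1..n+1}" "a \<noteq> b"
  show "\<beta> * (2 * k * of_nat i - 2 * l * (of_nat i - 1)) * four_cycle a b =
      \<beta> * laplacian n (layer_weight i k l) four_cycle a b"
    by (rule laplacian_eigenI[OF i(1) edge_function_four_cycle _ _ _ _ _ ab])
       (simp_all add: out out' row algebra_simps)
qed

section \<open>The spectrum and the central charges\<close>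

lemma id_sym_eq_scaled_sum:
  fixes \<alpha> :: "'f::field_char_0"
  assumes "j \<le> n" "1 + \<alpha> / 2 * of_nat (2 * (j - 1)) \<noteq> 0"
  shows "triple_system.regular_subspace (double_sym_space n) (points (sym_space j) \<times> {1}) (2 * (j - 1))"
    and "id_sym \<alpha> n j = scaled_sum \<alpha> (points (sym_space j) \<times> {1}) (2 * (j - 1))"
proof -
  show reg: "triple_system.regular_subspace (double_sym_space n) (points (sym_space j) \<times> {1}) (2 * (j - 1))"
    by (rule regular_subspaceI[where S = "{1}"]) (use assms in auto)
  have "(\<lambda>x. (x, 1::int)) ` points (sym_space j) = points (sym_space j) \<times> {1}" by auto
  then show "id_sym \<alpha> n j = scaled_sum \<alpha> (points (sym_space j) \<times> {1}) (2 * (j - 1))"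
    unfolding id_sym_def
    using triple_system.identity_of_free_space[OF triple_system_double_sym_space reg assms(2)] by simp
qed

lemma id_hat_eq_scaled_sum:
  fixes \<alpha> :: "'f::field_char_0"
  assumes "j \<le> n" "1 + \<alpha> / 2 * of_nat (4 * (j - 1)) \<noteq> 0"
  shows "triple_system.regular_subspace (double_sym_space n) (points (sym_space j) \<times> {1, -1}) (4 * (j - 1))"
    and "id_hat \<alpha> n j = scaled_sum \<alpha> (points (sym_space j) \<times> {1, -1}) (4 * (j - 1))"
proof -
  show reg: "triple_system.regular_subspace (double_sym_space n) (points (sym_space j) \<times> {1, -1}) (4 * (j - 1))"
    by (rule regular_subspaceI[where S = "{1, -1}"]) (use assms in auto)
  have "points (double_sym_space j) = points (sym_space j) \<times> {1, -1}"
    by (simp add: double_space_def)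
  then show "id_hat \<alpha> n j = scaled_sum \<alpha> (points (sym_space j) \<times> {1, -1}) (4 * (j - 1))"
    unfolding id_hat_def
    using triple_system.identity_of_free_space[OF triple_system_double_sym_space reg assms(2)] by simp
qed

lemma of_nat_card_sym_points:
  "of_nat (card (points (sym_space j))) = (of_nat j * (of_nat j + 1) / 2 :: 'f::field_char_0)"
proof -
  have "of_nat (2 * card (points (sym_space j))) = (of_nat (j * (j + 1)) :: 'f)"
    by (simp only: card_sym_points)
  then show ?thesis by (simp add: field_simps)
qed

text \<open>
  With \<open>k\<close> and \<open>l\<close> the coefficients of \<open>id\<^sub>i\<close> and \<open>id\<^bsub>i-1\<^esub>\<close>, the products \<open>\<alpha>/2 k (i+1)\<close> and \<open>\<alpha> k i\<close> are
  \<open>eta \<alpha> i\<close> and \<open>eta_hat \<alpha> i\<close>, while \<open>\<alpha>/2 l i\<close> and \<open>\<alpha> l (i-1)\<close> are the values at \<open>i - 1\<close>.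
\<close>

lemma spec_layer_idempotent:
  fixes \<alpha> k l :: "'f::field_char_0"
  assumes i: "4 \<le> i" "i < n"
    and k: "k * (1 + \<alpha> * (of_nat i - 1)) = 1" and l: "l * (1 + \<alpha> * (of_nat i - 2)) = 1"
    and ne: "1 - \<alpha> / 2 * l * of_nat i \<noteq> 0"
  defines "e \<equiv> id_sym \<alpha> n i - id_sym \<alpha> n (i - 1)"
  shows "Spec \<alpha> (double_sym_space n) e =
    {0, 1, \<alpha> / 2 * (k * (of_nat i + 1)), 1 - \<alpha> / 2 * l * of_nat i,
    \<alpha> / 2 * (k * (of_nat i + 1) - l * of_nat i), \<alpha> / 2 * (2 * k * of_nat i - l * of_nat i),
    \<alpha> / 2 * (2 * k * of_nat i - 2 * l * (of_nat i - 1))}" (is "_ = ?M")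
proof -
  interpret D: triple_system "double_sym_space n" by (rule triple_system_double_sym_space)
  let ?C = "points (sym_space i) \<times> {1::int}" and ?B = "points (sym_space (i - 1)) \<times> {1::int}"
  have nat: "of_nat (i - 1) = (of_nat i - 1 :: 'f)" "of_nat (i - 1 - 1) = (of_nat i - 2 :: 'f)"
    using i by (simp_all add: of_nat_diff)
  have kD: "1 + \<alpha> / 2 * of_nat (2 * (i - 1)) = 1 + \<alpha> * (of_nat i - 1)"
    and lD: "1 + \<alpha> / 2 * of_nat (2 * (i - 1 - 1)) = 1 + \<alpha> * (of_nat i - 2)"
    by (simp_all only: of_nat_mult nat) simp_all
  have k_nz: "1 + \<alpha> * (of_nat i - 1) \<noteq> 0" and l_nz: "1 + \<alpha> * (of_nat i - 2) \<noteq> 0"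
    using k l by auto
  have k_eq: "1 / (1 + \<alpha> * (of_nat i - 1)) = k" and l_eq: "1 / (1 + \<alpha> * (of_nat i - 2)) = l"
    using k l k_nz l_nz by (simp_all add: field_simps)
  have C: "D.regular_subspace ?C (2 * (i - 1))" "1 + \<alpha> / 2 * of_nat (2 * (i - 1)) \<noteq> 0"
    "id_sym \<alpha> n i = scaled_sum \<alpha> ?C (2 * (i - 1))"
    using id_sym_eq_scaled_sum[of i n \<alpha>] i k_nz unfolding kD by auto
  have B: "D.regular_subspace ?B (2 * (i - 1 - 1))" "1 + \<alpha> / 2 * of_nat (2 * (i - 1 - 1)) \<noteq> 0"
    "id_sym \<alpha> n (i - 1) = scaled_sum \<alpha> ?B (2 * (i - 1 - 1))"
    using id_sym_eq_scaled_sum[of "i - 1" n \<alpha>] i l_nz unfolding lD by auto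
  have BC: "?B \<subseteq> ?C" using i by (fastforce simp: sym_space_def)
  have idem: "idempotent \<alpha> (double_sym_space n) e"
    unfolding e_def C(3) B(3) by (rule D.idempotent_diff_scaled_sum[OF B(1,2) C(1,2) BC])
  then have e_in: "e \<in> free_space (points (double_sym_space n))" by (simp add: idempotent_def)
  have lookup: "Poly_Mapping.lookup e x = (if x \<in> ?C then k else 0) - (if x \<in> ?B then l else 0)" for x
    unfolding e_def C(3) B(3) lookup_minus D.lookup_scaled_sum[OF C(1,2)] D.lookup_scaled_sum[OF B(1,2)]
      kD lD k_eq l_eq by simp
  have e_pos: "Poly_Mapping.lookup e (transpose a b, 1) = layer_weight i k l a b"
    if "a \<in> {1..n+1}" "b \<in> {1..n+1}" "a \<noteq> b" for a b
    using that i transpose_in_sym_points[OF that(3), of i] transpose_in_sym_points[OF that(3), of "i - 1"]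
    unfolding lookup layer_weight_def by auto
  have e_neg: "Poly_Mapping.lookup e (x, -1) = 0" for x
    unfolding lookup by simp
  have eigenvalueI: "\<nu> \<in> Spec \<alpha> (double_sym_space n) e"
    if "edge_function p" "edge_function m" "a \<in> {1..n+1}" "b \<in> {1..n+1}" "p a b \<noteq> 0 \<or> m a b \<noteq> 0"
      "layer_eigenpair n i k l (\<alpha> / 2) \<nu> p m" for p m a b \<nu>
    by (rule layer_eigenvalueI[OF i(2) e_in _ e_neg that]) (rule e_pos)
  have k': "k * (1 + 2 * (\<alpha> / 2) * (of_nat i - 1)) = 1" and l': "l * (1 + 2 * (\<alpha> / 2) * (of_nat i - 2)) = 1"
    using k l by simp_all
  have i2: "2 \<le> i" using i by simp
  have letters: "1 \<in> {1..n+1}" "2 \<in> {1..n+1}" "i + 1 \<in> {1..n+1}" "i + 2 \<in> {1..n+1}" using i by auto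
  have scale_edge: "edge_function (\<lambda>a b. c * f a b)" if "edge_function f" for f :: "nat \<Rightarrow> nat \<Rightarrow> 'f" and c
    using that unfolding edge_function_def by simp
  have uminus_edge: "edge_function (\<lambda>a b. - f a b)" if "edge_function f" for f :: "nat \<Rightarrow> nat \<Rightarrow> 'f"
    using that unfolding edge_function_def by simp
  show ?thesis
  proof (intro subset_antisym subsetI)
    fix \<mu> assume "\<mu> \<in> Spec \<alpha> (double_sym_space n) e"
    then obtain p m a b where "edge_function p" "edge_function m"
      "a \<in> {1..n+1}" "b \<in> {1..n+1}" "p a b \<noteq> 0 \<or> m a b \<noteq> 0"
      "layer_eigenpair n i k l (\<alpha> / 2) \<mu> p m"
      by (rule layer_eigenvalueE[OF i(2) e_in _ e_neg, rotated]) (use e_pos in blast)+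
    then show "\<mu> \<in> ?M"
      by (intro layer_eigenpair_subset[OF i(2) i2 _ _ k' l'])
  next
    have k_ne: "k \<noteq> 0" using k by auto
    have deg0: "2 * (\<alpha> / 2) * x \<noteq> 0 \<or> (1 - 2 * (\<alpha> / 2)) * x \<noteq> 0" if "x \<noteq> 0" for x
      using that by auto
    \<comment> \<open>Both identities fix the point \<open>(1,2)\<^sup>+\<close>.\<close>
    have zero: "0 \<in> Spec \<alpha> (double_sym_space n) e"
    proof -
      let ?v = "Poly_Mapping.single (transpose 1 2, 1) 1 :: (nat \<Rightarrow> nat) \<times> int \<Rightarrow>\<^sub>0 'f"
      have "transpose 1 2 \<in> points (sym_space (i - 1))"
        using transpose_in_sym_points[of 1 2 "i - 1"] i by auto
      then have vB: "?v \<in> free_space ?B" by (simp add: free_space_def)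
      then have vC: "?v \<in> free_space ?C" using BC unfolding free_space_def by auto
      then have vG: "?v \<in> free_space (points (double_sym_space n))"
        using D.free_space_subspace[OF C(1,2)] by blast
      have bary: "scaled_sum \<alpha> ?C (2 * (i - 1)) \<in> free_space (points (double_sym_space n))"
        "scaled_sum \<alpha> ?B (2 * (i - 1 - 1)) \<in> free_space (points (double_sym_space n))"
        using D.scaled_sum_in_free_space[OF C(1,2)] D.free_space_subspace[OF C(1,2)]
          D.scaled_sum_in_free_space[OF B(1,2)] D.free_space_subspace[OF B(1,2)] by blast+
      have "matsuo_mult \<alpha> (double_sym_space n) ?v e = 0"
        unfolding e_def C(3) B(3) D.matsuo_mult_diff(2)[OF bary vG]
          D.scaled_sum_mult[OF C(1,2) vC] D.scaled_sum_mult[OF B(1,2) vB] by simp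
      then have "matsuo_mult \<alpha> (double_sym_space n) e ?v = scale 0 ?v"
        using D.matsuo_mult_commute[OF vG e_in, of \<alpha>] by (auto intro: poly_mapping_eqI)
      moreover have "?v \<noteq> 0" by (metis lookup_single_eq lookup_zero zero_neq_one)
      ultimately show ?thesis unfolding Spec_def using vG by blast
    qed
    have one: "1 \<in> Spec \<alpha> (double_sym_space n) e"
    proof -
      have "e \<noteq> 0" using e_pos[of 1 "i + 1"] letters i k_ne by (auto simp: layer_weight_def)
      moreover have "scale 1 e = e" by (auto intro: poly_mapping_eqI)
      ultimately show ?thesis using idem e_in unfolding Spec_def idempotent_def by force
    qed
    have "\<alpha> / 2 * (k * (of_nat i + 1)) \<in> Spec \<alpha> (double_sym_space n) e"
      (is "?\<mu> \<in> _")
    proof -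
      \<comment> \<open>With values adding up to zero on \<open>{1..i+1}\<close> it is an eigenfunction for \<open>id\<^sub>i\<close>; being constant on
        \<open>{1..i}\<close>, it is killed by \<open>id\<^bsub>i-1\<^esub>\<close>.\<close>
      let ?\<psi> = "\<lambda>a. if a = Suc i then - of_nat i else 1 :: 'f"
      have sum: "(\<Sum>d\<in>{1..i}. ?\<psi> d) = of_nat i"
        by (subst sum.cong[OF refl, of _ _ "\<lambda>_. 1"]) auto
      have "layer_eigenpair n i k l (\<alpha> / 2) ?\<mu> (outer_star i ?\<psi>) (\<lambda>a b. - outer_star i ?\<psi> a b)"
        by (rule outer_star_eigenpair[OF i(2)]; unfold sum) (auto simp: algebra_simps)
      moreover have "outer_star i ?\<psi> 1 (i + 2) \<noteq> 0" using i by (simp add: outer_star_def)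
      ultimately show ?thesis
        using eigenvalueI[OF edge_function_outer_star uminus_edge[OF edge_function_outer_star] letters(1,4)] by blast
    qed
    moreover have "\<alpha> / 2 * (k * (of_nat i + 1) - l * of_nat i) \<in> Spec \<alpha> (double_sym_space n) e"
      (is "?\<mu> \<in> _")
    proof -
      have "layer_eigenpair n i k l (\<alpha> / 2) ?\<mu> (outer_star i unit_difference) (\<lambda>a b. - outer_star i unit_difference a b)"
        by (rule outer_star_eigenpair[OF i(2)]; unfold sum_unit_difference[OF i2])
           (use i2 in \<open>auto simp: unit_difference_def[of "Suc i"] algebra_simps\<close>)
      moreover have "outer_star i unit_difference 1 (i + 2) \<noteq> (0::'f)" using i by (simp add: outer_star_def unit_difference_def)
      ultimately show ?thesis
        using eigenvalueI[OF edge_function_outer_star uminus_edge[OF edge_function_outer_star] letters(1,4)] by blast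
    qed
    moreover have "1 - \<alpha> / 2 * l * of_nat i \<in> Spec \<alpha> (double_sym_space n) e" (is "?\<mu> \<in> _")
    proof -
      have star_nz: "star i s 1 (i + 1) \<noteq> (0::'f)" for s using i by (simp add: star_def unit_difference_def)
      have "edge_function (\<lambda>_ _. 0 :: 'f)" by (simp add: edge_function_def)
      then show ?thesis
        by (rule eigenvalueI[OF edge_function_star _ letters(1,3) disjI1[OF star_nz]
            star_subalgebra_eigenpair[OF i(2) i2 k' l' ne]])
    qed
    moreover have "\<alpha> / 2 * (2 * k * of_nat i - l * of_nat i) \<in> Spec \<alpha> (double_sym_space n) e"
    proof -
      have "star i s 1 (i + 1) \<noteq> (0::'f)" for s using i by (simp add: star_def unit_difference_def)
      note nz = deg0[OF this]
      show ?thesis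
        by (rule eigenvalueI[OF scale_edge[OF edge_function_star] scale_edge[OF edge_function_star] letters(1,3) nz])
           (rule star_degree_zero_eigenpair, use i in auto)
    qed
    moreover have "\<alpha> / 2 * (2 * k * of_nat i - 2 * l * (of_nat i - 1)) \<in> Spec \<alpha> (double_sym_space n) e"
    proof -
      have "four_cycle 1 2 \<noteq> (0::'f)" by (simp add: four_cycle_def)
      note nz = deg0[OF this]
      show ?thesis
        by (rule eigenvalueI[OF scale_edge[OF edge_function_four_cycle] scale_edge[OF edge_function_four_cycle] letters(1,2) nz])
           (rule four_cycle_eigenpair[OF i(2,1)])
    qed
    moreover fix \<mu> assume "\<mu> \<in> ?M"
    ultimately show "\<mu> \<in> Spec \<alpha> (double_sym_space n) e"
      using zero one by blast
  qed
qed

theorem lemma4p8: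
  fixes i n :: nat
    and \<alpha> c :: "'f::field_char_0"
    and \<eta> \<eta>h :: "nat \<Rightarrow> 'f"
    and e eh :: "(nat \<Rightarrow> nat) \<times> int \<Rightarrow>\<^sub>0 'f"
  assumes "4 \<le> i" and "i < n"
    and "\<alpha> = 1 / 4" and "c = 1 / 2"
    and "\<eta> = eta \<alpha>" and "\<eta>h = eta_hat \<alpha>"
    and "e = id_sym \<alpha> n i - id_sym \<alpha> n (i - 1)"
    and "eh = id_hat \<alpha> n i - id_sym \<alpha> n i"
  shows "idempotent \<alpha> (double_sym_space n) e
    \<and> idempotent \<alpha> (double_sym_space n) eh
    \<and> central_charge \<alpha> c (double_sym_space n) e = 1 - 6 / ((of_nat i + 2) * (of_nat i + 3))
    \<and> 1 - 6 / ((of_nat i + 2) * (of_nat i + 3)) = (vir_c i :: 'f)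
    \<and> central_charge \<alpha> c (double_sym_space n) eh = 2 * of_nat i / (of_nat i + 3)
    \<and> 1 \<in> Spec \<alpha> (double_sym_space n) e
    \<and> Spec \<alpha> (double_sym_space n) e - {1} =
      {0, \<eta> i, 1 - \<eta> (i - 1), \<eta> i - \<eta> (i - 1), \<eta>h i - \<eta> (i - 1), \<eta>h i - \<eta>h (i - 1)}
    \<and> 0 = (vir_h i 1 1 :: 'f)
    \<and> \<eta> i = 1 / 2 * ((of_nat i + 1) / (of_nat i + 3))
    \<and> 1 / 2 * ((of_nat i + 1) / (of_nat i + 3)) = (1 / 2 * vir_h i 1 3 :: 'f)
    \<and> 1 - \<eta> (i - 1) = 1 / 2 * ((of_nat i + 4) / (of_nat i + 2))
    \<and> 1 / 2 * ((of_nat i + 4) / (of_nat i + 2)) = (1 / 2 * vir_h i 3 1 :: 'f)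
    \<and> \<eta> i - \<eta> (i - 1) = 1 / ((of_nat i + 2) * (of_nat i + 3))
    \<and> 1 / ((of_nat i + 2) * (of_nat i + 3)) = (1 / 2 * vir_h i 3 3 :: 'f)
    \<and> \<eta>h i - \<eta> (i - 1) =
      1 / 2 * ((of_nat i * (of_nat i + 1)) / ((of_nat i + 2) * (of_nat i + 3)))
    \<and> 1 / 2 * ((of_nat i * (of_nat i + 1)) / ((of_nat i + 2) * (of_nat i + 3)))
      = (1 / 2 * vir_h i 3 5 :: 'f)
    \<and> \<eta>h i - \<eta>h (i - 1) = 3 / ((of_nat i + 2) * (of_nat i + 3))
    \<and> 3 / ((of_nat i + 2) * (of_nat i + 3)) = (1 / 2 * vir_h i 5 5 :: 'f)"
proof -
  interpret D: triple_system "double_sym_space n" by (rule triple_system_double_sym_space)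
  note i = \<open>4 \<le> i\<close> \<open>i < n\<close>
  note \<alpha> = \<open>\<alpha> = 1 / 4\<close>
  define x :: 'f where "x = of_nat i"
  have nz: "x + 2 \<noteq> 0" "x + 3 \<noteq> 0" "x + 1 \<noteq> 0" "x + 4 \<noteq> 0" "x \<noteq> 0"
  proof -
    have "x + 2 = of_nat (i + 2)" "x + 3 = of_nat (i + 3)" "x + 1 = of_nat (i + 1)" "x + 4 = of_nat (i + 4)"
      by (simp_all add: x_def)
    then show "x + 2 \<noteq> 0" "x + 3 \<noteq> 0" "x + 1 \<noteq> 0" "x + 4 \<noteq> 0" "x \<noteq> 0"
      using i by (simp_all only: x_def of_nat_eq_0_iff)
  qed
  have nz2: "2 * x + 6 \<noteq> 0" "2 * x + 4 \<noteq> 0" "2 * x + 2 \<noteq> 0"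
  proof -
    have "2 * x + 6 = 2 * (x + 3)" "2 * x + 4 = 2 * (x + 2)" "2 * x + 2 = 2 * (x + 1)" by simp_all
    with nz show "2 * x + 6 \<noteq> 0" "2 * x + 4 \<noteq> 0" "2 * x + 2 \<noteq> 0"
      by (metis mult_eq_0_iff zero_neq_numeral)+
  qed
  have pred: "of_nat (i - 1) = x - 1" "of_nat (i - 1 - 1) = x - 2"
    using i by (simp_all add: x_def of_nat_diff)
  let ?C = "points (sym_space i) \<times> {1::int}" and ?B = "points (sym_space (i - 1)) \<times> {1::int}"
    and ?H = "points (sym_space i) \<times> {1, -1::int}"
  have degC: "1 + \<alpha> / 2 * of_nat (2 * (i - 1)) = (x + 3) / 4"
    and degB: "1 + \<alpha> / 2 * of_nat (2 * (i - 1 - 1)) = (x + 2) / 4"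
    and degH: "1 + \<alpha> / 2 * of_nat (4 * (i - 1)) = (x + 1) / 2"
    by (simp_all only: of_nat_mult pred \<alpha>) (simp_all add: field_simps)
  have C: "D.regular_subspace ?C (2 * (i - 1))" "1 + \<alpha> / 2 * of_nat (2 * (i - 1)) \<noteq> 0"
    "id_sym \<alpha> n i = scaled_sum \<alpha> ?C (2 * (i - 1))"
    using id_sym_eq_scaled_sum[of i n \<alpha>] i nz unfolding degC by auto
  have B: "D.regular_subspace ?B (2 * (i - 1 - 1))" "1 + \<alpha> / 2 * of_nat (2 * (i - 1 - 1)) \<noteq> 0"
    "id_sym \<alpha> n (i - 1) = scaled_sum \<alpha> ?B (2 * (i - 1 - 1))"
    using id_sym_eq_scaled_sum[of "i - 1" n \<alpha>] i nz unfolding degB by auto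
  have H: "D.regular_subspace ?H (4 * (i - 1))" "1 + \<alpha> / 2 * of_nat (4 * (i - 1)) \<noteq> 0"
    "id_hat \<alpha> n i = scaled_sum \<alpha> ?H (4 * (i - 1))"
    using id_hat_eq_scaled_sum[of i n \<alpha>] i nz unfolding degH by auto
  have BC: "?B \<subseteq> ?C" using i by (fastforce simp: sym_space_def)
  have CH: "?C \<subseteq> ?H" by auto
  have cardC: "of_nat (card ?C) = x * (x + 1) / 2" and cardB: "of_nat (card ?B) = (x - 1) * x / 2"
    and cardH: "of_nat (card ?H) = x * (x + 1)"
    using pred by (simp_all add: card_cartesian_product of_nat_card_sym_points x_def[symmetric])
  have idem: "idempotent \<alpha> (double_sym_space n) e"
    unfolding \<open>e = _\<close> C(3) B(3) by (rule D.idempotent_diff_scaled_sum[OF B(1,2) C(1,2) BC])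
  have idem_hat: "idempotent \<alpha> (double_sym_space n) eh"
    unfolding \<open>eh = _\<close> C(3) H(3) by (rule D.idempotent_diff_scaled_sum[OF C(1,2) H(1,2) CH])
  have cc: "central_charge \<alpha> c (double_sym_space n) e = 1 - 6 / ((x + 2) * (x + 3))"
    unfolding \<open>e = _\<close> C(3) B(3) D.central_charge_diff_scaled_sum[OF B(1,2) C(1,2) BC]
      degC degB cardC cardB \<open>c = _\<close>
    using nz nz2 by (simp add: divide_simps) (simp add: algebra_simps)
  have cc_hat: "central_charge \<alpha> c (double_sym_space n) eh = 2 * x / (x + 3)"
    unfolding \<open>eh = _\<close> C(3) H(3) D.central_charge_diff_scaled_sum[OF C(1,2) H(1,2) CH]
      degC degH cardC cardH \<open>c = _\<close>
    using nz nz2 by (simp add: divide_simps) (simp add: algebra_simps)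
  have eta: "\<eta> i = 1 / 2 * ((x + 1) / (x + 3))" "\<eta> (i - 1) = 1 / 2 * (x / (x + 2))"
    "\<eta>h i = x / (x + 3)" "\<eta>h (i - 1) = (x - 1) / (x + 2)"
  proof -
    have denominators: "2 + 2 * (1 / 4) * (x - 1) = (x + 3) / 2" "2 + 2 * (1 / 4) * (x - 1 - 1) = (x + 2) / 2"
      "1 + 1 / 4 * (x - 1) = (x + 3) / 4" "1 + 1 / 4 * (x - 1 - 1) = (x + 2) / 4"
      by (simp_all add: field_simps)
    have quotient: "1 / 4 * y / (q / 2) = 1 / 2 * (y / q)" "1 / 4 * y / (q / 4) = y / q" for y q :: 'f
      by simp_all
    show "\<eta> i = 1 / 2 * ((x + 1) / (x + 3))" "\<eta> (i - 1) = 1 / 2 * (x / (x + 2))"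
      "\<eta>h i = x / (x + 3)" "\<eta>h (i - 1) = (x - 1) / (x + 2)"
      unfolding \<open>\<eta> = _\<close> \<open>\<eta>h = _\<close> eta_def eta_hat_def \<alpha> pred x_def[symmetric]
        denominators diff_add_cancel by (rule quotient)+
  qed
  have diffs: "1 - \<eta> (i - 1) = 1 / 2 * ((x + 4) / (x + 2))"
    "\<eta> i - \<eta> (i - 1) = 1 / ((x + 2) * (x + 3))"
    "\<eta>h i - \<eta> (i - 1) = 1 / 2 * ((x * (x + 1)) / ((x + 2) * (x + 3)))"
    "\<eta>h i - \<eta>h (i - 1) = 3 / ((x + 2) * (x + 3))"
    unfolding eta using nz nz2 by (simp_all add: divide_simps) (simp_all add: algebra_simps)
  have kl: "4 / (x + 3) * (1 + \<alpha> * (x - 1)) = 1" "4 / (x + 2) * (1 + \<alpha> * (x - 2)) = 1"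
  proof -
    have denominators: "1 + \<alpha> * (x - 1) = (x + 3) / 4" "1 + \<alpha> * (x - 2) = (x + 2) / 4"
      by (simp_all add: \<alpha> field_simps)
    have "4 / q * (q / 4) = 1" if "q \<noteq> 0" for q :: 'f
      using that by simp
    then show "4 / (x + 3) * (1 + \<alpha> * (x - 1)) = 1" "4 / (x + 2) * (1 + \<alpha> * (x - 2)) = 1"
      unfolding denominators using nz by blast+
  qed
  have scaled: "1 / 4 / 2 * (4 / q * y) = 1 / 2 * (y / q)"
    "1 / 4 / 2 * (4 / q * y - 4 / p * z) = 1 / 2 * (y / q) - 1 / 2 * (z / p)"
    "1 / 4 / 2 * (2 * (4 / q) * y - 4 / p * z) = y / q - 1 / 2 * (z / p)"
    "1 / 4 / 2 * (2 * (4 / q) * y - 2 * (4 / p) * z) = y / q - z / p" for p q y z :: 'f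
    by (simp_all add: right_diff_distrib)
  have spectrum_values: "\<alpha> / 2 * (4 / (x + 3) * (x + 1)) = \<eta> i"
    "1 - \<alpha> / 2 * (4 / (x + 2)) * x = 1 - \<eta> (i - 1)"
    "\<alpha> / 2 * (4 / (x + 3) * (x + 1) - 4 / (x + 2) * x) = \<eta> i - \<eta> (i - 1)"
    "\<alpha> / 2 * (2 * (4 / (x + 3)) * x - 4 / (x + 2) * x) = \<eta>h i - \<eta> (i - 1)"
    "\<alpha> / 2 * (2 * (4 / (x + 3)) * x - 2 * (4 / (x + 2)) * (x - 1)) = \<eta>h i - \<eta>h (i - 1)"
    unfolding eta \<alpha> mult.assoc[of "1 / 4 / 2"] scaled by (rule refl)+
  have "1 - \<eta> (i - 1) \<noteq> 0"
    unfolding diffs using nz nz2 by simp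
  then have spec: "Spec \<alpha> (double_sym_space n) e = {0, 1, \<eta> i, 1 - \<eta> (i - 1), \<eta> i - \<eta> (i - 1),
      \<eta>h i - \<eta> (i - 1), \<eta>h i - \<eta>h (i - 1)}"
    using spec_layer_idempotent[OF i, of "4 / (x + 3)" \<alpha> "4 / (x + 2)"] kl
    unfolding x_def[symmetric] spectrum_values \<open>e = _\<close> by blast
  have not_1: "\<eta> i \<noteq> 1" "1 - \<eta> (i - 1) \<noteq> 1" "\<eta> i - \<eta> (i - 1) \<noteq> 1"
      "\<eta>h i - \<eta> (i - 1) \<noteq> 1" "\<eta>h i - \<eta>h (i - 1) \<noteq> 1"
  proof -
    have quotient: "y \<noteq> q \<Longrightarrow> y / q \<noteq> 1" "y \<noteq> 2 * q \<Longrightarrow> 1 / 2 * (y / q) \<noteq> 1"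
      if "q \<noteq> 0" for y q :: 'f
      using that by (auto simp: field_simps)
    have nz3: "(x + 2) * (x + 3) \<noteq> 0" using nz by simp
    have "of_nat (i + 1) \<noteq> (of_nat (2 * (i + 3)) :: 'f)" unfolding of_nat_eq_iff by simp
    then have "x + 1 \<noteq> 2 * (x + 3)" by (simp only: x_def of_nat_add of_nat_mult of_nat_1 of_nat_numeral not_False_eq_True)
    then show "\<eta> i \<noteq> 1" unfolding eta by (rule quotient(2)[OF nz(2)])
    show "1 - \<eta> (i - 1) \<noteq> 1" unfolding eta using nz nz2 by simp
    have "of_nat 1 \<noteq> (of_nat ((i + 2) * (i + 3)) :: 'f)" unfolding of_nat_eq_iff by simp
    then have "1 \<noteq> (x + 2) * (x + 3)" by (simp only: x_def of_nat_add of_nat_mult of_nat_1 of_nat_numeral not_False_eq_True)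
    then show "\<eta> i - \<eta> (i - 1) \<noteq> 1" unfolding diffs by (rule quotient(1)[OF nz3])
    have "of_nat (i * (i + 1)) \<noteq> (of_nat (2 * ((i + 2) * (i + 3))) :: 'f)"
      unfolding of_nat_eq_iff by (simp add: algebra_simps)
    then have "x * (x + 1) \<noteq> 2 * ((x + 2) * (x + 3))" by (simp only: x_def of_nat_add of_nat_mult of_nat_1 of_nat_numeral not_False_eq_True)
    then show "\<eta>h i - \<eta> (i - 1) \<noteq> 1" unfolding diffs by (rule quotient(2)[OF nz3])
    have "of_nat 3 \<noteq> (of_nat ((i + 2) * (i + 3)) :: 'f)"
      unfolding of_nat_eq_iff by (simp add: algebra_simps)
    then have "3 \<noteq> (x + 2) * (x + 3)" by (simp only: x_def of_nat_add of_nat_mult of_nat_1 of_nat_numeral not_False_eq_True)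
    then show "\<eta>h i - \<eta>h (i - 1) \<noteq> 1" unfolding diffs by (rule quotient(1)[OF nz3])
  qed
  have vir: "vir_h i 1 1 = (0::'f)" "vir_h i 1 3 = (x + 1) / (x + 3)" "vir_h i 3 1 = (x + 4) / (x + 2)"
    "vir_h i 3 3 = 2 / ((x + 2) * (x + 3))" "vir_h i 3 5 = x * (x + 1) / ((x + 2) * (x + 3))"
    "vir_h i 5 5 = 6 / ((x + 2) * (x + 3))"
  proof -
    have numerators: "(1 * (x + 3) - 1 * (x + 2))^2 - 1 = 4 * 0"
      "(1 * (x + 3) - 3 * (x + 2))^2 - 1 = 4 * (x + 2) * (x + 1)"
      "(3 * (x + 3) - 1 * (x + 2))^2 - 1 = 4 * (x + 3) * (x + 4)"
      "(3 * (x + 3) - 3 * (x + 2))^2 - 1 = 4 * 2"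
      "(3 * (x + 3) - 5 * (x + 2))^2 - 1 = 4 * (x * (x + 1))"
      "(5 * (x + 3) - 5 * (x + 2))^2 - 1 = 4 * 6"
      by (simp_all add: algebra_simps power2_eq_square)
    have cancel: "4 * y / (4 * p * q) = y / (p * q)" "p \<noteq> 0 \<Longrightarrow> 4 * p * y / (4 * p * q) = y / q"
      "q \<noteq> 0 \<Longrightarrow> 4 * q * y / (4 * p * q) = y / p" for p q y :: 'f
      by simp_all
    have "vir_h i 1 1 = (0 / ((x + 2) * (x + 3)) :: 'f)"
      unfolding vir_h_def x_def[symmetric] of_nat_1 numerators by (rule cancel)
    then show "vir_h i 1 1 = (0::'f)" by simp
    show "vir_h i 1 3 = (x + 1) / (x + 3)" "vir_h i 3 1 = (x + 4) / (x + 2)"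
      "vir_h i 3 3 = 2 / ((x + 2) * (x + 3))" "vir_h i 3 5 = x * (x + 1) / ((x + 2) * (x + 3))"
      "vir_h i 5 5 = 6 / ((x + 2) * (x + 3))"
      unfolding vir_h_def x_def[symmetric] of_nat_1 of_nat_numeral numerators
      by (rule cancel nz)+
  qed
  have "Spec \<alpha> (double_sym_space n) e - {1} =
      {0, \<eta> i, 1 - \<eta> (i - 1), \<eta> i - \<eta> (i - 1), \<eta>h i - \<eta> (i - 1), \<eta>h i - \<eta>h (i - 1)}"
    unfolding spec using not_1 by auto
  moreover have "1 \<in> Spec \<alpha> (double_sym_space n) e" unfolding spec by simp
  ultimately show ?thesis
    unfolding x_def[symmetric] vir vir_c_def using idem idem_hat cc cc_hat eta(1) diffs by simp
qed

end
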